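(* Let $\Bbbk$ be a field of characteristic $0$, let $(P,\cdot,[-,-],\Delta,\delta)$ be a finite-dimensional Poisson bialgebra over $\Bbbk$, let $(B,\circ_B,\omega)$ be a finite-dimensional quadratic perm algebra, and let $(P\otimes B,\circ,\ast,\nu,\vartheta)$ be the induced DPP bialgebra: $(p_1\otimes b_1)\circ(p_2\otimes b_2)=(p_1p_2)\otimes(b_1\circ_B b_2)$, $(p_1\otimes b_1)\ast(p_2\otimes b_2)=[p_1,p_2]\otimes(b_1\circ_B b_2)$, $\nu(p\otimes b)=\Delta(p)\bullet\nu_\omega(b)$, $\vartheta(p\otimes b)=\delta(p)\bullet\nu_\omega(b)$. If $(P,\cdot,[-,-],\Delta,\delta)$ is factorizable, then $(P\otimes B,\circ,\ast,\nu,\vartheta)$ is factorizable.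
   Context: All vector spaces are finite-dimensional over a field $\Bbbk$ of characteristic $0$; $\tau(x\otimes y)=y\otimes x$; for $s\in V\otimes V$, $s^\sharp:V^*\to V$ is $\langle s^\sharp(\xi_1),\xi_2\rangle=\langle\xi_1\otimes\xi_2,s\rangle$. **Poisson bialgebras.** A Poisson algebra $(P,\cdot,[-,-])$ is a commutative associative (not necessarily unital) algebra and a Lie algebra with $[p_1,p_2p_3]=[p_1,p_2]p_3+p_2[p_1,p_3]$. Let $u(p)q=pq$, $\mathrm{ad}(p)q=[p,q]$. A Poisson coalgebra $(P,\Delta,\delta)$ satisfies $\tau\Delta=\Delta$, $(\Delta\otimes\mathrm{id})\Delta=(\mathrm{id}\otimes\Delta)\Delta$, $\tau\delta=-\delta$, $(\mathrm{id}\otimes\delta)\delta-(\tau\otimes\mathrm{id})(\mathrm{id}\otimes\delta)\delta=(\delta\otimes\mathrm{id})\delta$, $(\mathrm{id}\otimes\Delta)\delta=(\delta\otimes\mathrm{id})\Delta+(\tau\otimes\mathrm{id})(\mathrm{id}\otimes\delta)\Delta$. A Poisson bialgebra is a Poisson algebra and Poisson coalgebra such that for all $p_1,p_2$: $\Delta(p_1p_2)=(u(p_2)\otimes\mathrm{id})\Delta(p_1)+(\mathrm{id}\otimes u(p_1))\Delta(p_2)$; $\delta([p_1,p_2])=(\mathrm{ad}(p_1)\otimes\mathrm{id}+\mathrm{id}\otimes\mathrm{ad}(p_1))\delta(p_2)-(\mathrm{ad}(p_2)\otimes\mathrm{id}+\mathrm{id}\otimes\mathrm{ad}(p_2))\delta(p_1)$;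 $\Delta([p_1,p_2])=(\mathrm{ad}(p_1)\otimes\mathrm{id}+\mathrm{id}\otimes\mathrm{ad}(p_1))\Delta(p_2)+(u(p_2)\otimes\mathrm{id}-\mathrm{id}\otimes u(p_2))\delta(p_1)$; $\delta(p_1p_2)=(u(p_1)\otimes\mathrm{id})\delta(p_2)+(u(p_2)\otimes\mathrm{id})\delta(p_1)+(\mathrm{id}\otimes\mathrm{ad}(p_1))\Delta(p_2)+(\mathrm{id}\otimes\mathrm{ad}(p_2))\Delta(p_1)$. For $r\in P\otimes P$: $\Delta_r(p)=(\mathrm{id}\otimes u(p)-u(p)\otimes\mathrm{id})(r)$, $\delta_r(p)=(\mathrm{id}\otimes\mathrm{ad}(p)+\mathrm{ad}(p)\otimes\mathrm{id})(r)$; $r$ is Poi-invariant if $\Delta_r=\delta_r=0$. For $r=\sum_i x_i\otimes y_i$ the PoiYBE is the pair $\sum_{i,j}(x_ix_j\otimes y_i\otimes y_j+x_i\otimes x_j\otimes y_iy_j-x_j\otimes x_iy_j\otimes y_i)=0$, $\sum_{i,j}([x_i,x_j]\otimes y_i\otimes y_j+x_i\otimes x_j\otimes[y_i,y_j]+x_i\otimes[y_i,x_j]\otimes y_j)=0$. A Poisson bialgebra is factorizable if $\Delta=\Delta_r$, $\delta=\delta_r$ for some solution $r\in P\otimes P$ of the PoiYBE such that $r+\tau(r)$ is Poi-invariant and $r^\sharp+\tau(r)^\sharp:P^*\to P$ is a linear isomorphism. **Quadratic perm algebras.** A perm algebra $(B,\circ_B)$ satisfies $b_1\circ(b_2\circ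 b_3)=(b_1\circ b_2)\circ b_3=(b_2\circ b_1)\circ b_3$. It is quadratic with $\omega$ if $\omega$ is a skew-symmetric nondegenerate bilinear form with $\omega(b_1\circ_B b_2,b_3)=\omega(b_1,b_2\circ_B b_3-b_3\circ_B b_2)$. $\nu_\omega:B\to B\otimes B$ is determined by $(\omega\otimes\omega)(\nu_\omega(b_1),b_2\otimes b_3)=-\omega(b_1,b_2\circ_B b_3)$, where $(\omega\otimes\omega)(x\otimes y,b\otimes b')=\omega(x,b)\omega(y,b')$. $(p'\otimes p'')\bullet(b'\otimes b'')=(p'\otimes b')\otimes(p''\otimes b'')$, extended bilinearly. **DPP bialgebras.** A (left) Leibniz algebra satisfies $a_1\ast(a_2\ast a_3)=(a_1\ast a_2)\ast a_3+a_2\ast(a_1\ast a_3)$. A DPP algebra $(A,\circ,\ast)$ is a perm algebra $(A,\circ)$ and a Leibniz algebra $(A,\ast)$ with $(a_1\circ a_2)\ast a_3=a_1\circ(a_2\ast a_3)+a_2\circ(a_1\ast a_3)$ and $(a_1\ast a_2)\circ a_3=a_1\ast(a_2\circ a_3)-a_2\circ(a_1\ast a_3)=-(a_2\ast a_1)\circ a_3$. A DPP coalgebra $(A,\nu,\vartheta)$ satisfies $(\nu\otimes\mathrm{id})\nu=(\mathrm{id}\otimes\nu)\nu=(\tau\otimes\mathrm{id})(\mathrm{id}\otimes\nu)\nu$, $(\mathrm{id}\otimes\vartheta)\vartheta=(\vartheta\otimes\mathrm{id})\vartheta+(\tau\otimes\mathrm{id})(\mathrm{id}\otimes\vartheta)\vartheta$,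 $(\mathrm{id}\otimes\nu)\vartheta=(\vartheta\otimes\mathrm{id})\nu+(\tau\otimes\mathrm{id})(\mathrm{id}\otimes\vartheta)\nu$, $(\nu\otimes\mathrm{id})\vartheta=(\mathrm{id}\otimes\vartheta)\nu+(\tau\otimes\mathrm{id})(\mathrm{id}\otimes\vartheta)\nu$, $(\vartheta\otimes\mathrm{id})\nu=-(\tau\otimes\mathrm{id})(\vartheta\otimes\mathrm{id})\nu$. Write $L(a)b=a\circ b$, $R(a)b=b\circ a$, $\tilde L(a)b=a\ast b$, $\tilde R(a)b=b\ast a$, $\nu^-=\nu-\tau\nu$, $\vartheta^+=\vartheta+\tau\vartheta$. $(A,\circ,\ast,\nu,\vartheta)$ is a DPP bialgebra if $(A,\circ,\ast)$ is a DPP algebra, $(A,\nu,\vartheta)$ is a DPP coalgebra, and for all $a_1,a_2\in A$: (perm bialgebra) $(R(a_1)\otimes\mathrm{id})\nu(a_2)=\tau((R(a_2)\otimes\mathrm{id})\nu(a_1))$; $\nu(a_1\circ a_2)=((L-R)(a_1)\otimes\mathrm{id})\nu(a_2)+(\mathrm{id}\otimes R(a_2))\nu(a_1)$; $\nu(a_1\circ a_2)=(\mathrm{id}\otimes L(a_1))\nu(a_2)+((L-R)(a_2)\otimes\mathrm{id})\nu^-(a_1)$; (Leibniz bialgebra) $\tau((\tilde R(a_2)\otimes\mathrm{id})\vartheta(a_1))=(\tilde R(a_1)\otimes\mathrm{id})\vartheta(a_2)$; $\vartheta(a_1\ast a_2)=(\mathrm{id}\otimes\tilde R(a_2)-(\tilde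 L+\tilde R)(a_2)\otimes\mathrm{id})\vartheta^+(a_1)+(\mathrm{id}\otimes\tilde L(a_1)+\tilde L(a_1)\otimes\mathrm{id})\vartheta(a_2)$; 1. $\nu(a_1\ast a_2)=(\mathrm{id}\otimes\tilde L(a_1)+\tilde L(a_1)\otimes\mathrm{id})\nu(a_2)+((L-R)(a_2)\otimes\mathrm{id}-\mathrm{id}\otimes R(a_2))\vartheta^+(a_1)$; 2. $\vartheta(a_1\circ a_2)=(\mathrm{id}\otimes L(a_1))\vartheta(a_2)+(\mathrm{id}\otimes R(a_2))\vartheta(a_1)-((\tilde L+\tilde R)(a_1)\otimes\mathrm{id})\nu(a_2)-((\tilde L+\tilde R)(a_2)\otimes\mathrm{id})\nu^-(a_1)$; 3. $(\mathrm{id}\otimes\tilde R(a_1))\tau\nu(a_2)=-(R(a_2)\otimes\mathrm{id})\vartheta(a_1)$; 4. $\nu(a_1\ast a_2)=(\mathrm{id}\otimes L(a_1)-L(a_1)\otimes\mathrm{id})\vartheta(a_2)+(\mathrm{id}\otimes\tilde R(a_2)-(\tilde L+\tilde R)(a_2)\otimes\mathrm{id})\nu^-(a_1)$; 5. $\vartheta^+(a_1\circ a_2)=(\mathrm{id}\otimes L(a_1))\vartheta^+(a_2)+(\mathrm{id}\otimes L(a_2))\vartheta^+(a_1)-(\tilde L(a_1)\otimes\mathrm{id})\nu^-(a_2)-(\tilde L(a_2)\otimes\mathrm{id})\nu^-(a_1)$; 6. $\vartheta(a_1\circ a_2)=(L(a_1)\otimes\mathrm{id})\vartheta(a_2)-(\mathrm{id}\otimes\tilde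 R(a_2))\nu^-(a_1)+(\mathrm{id}\otimes\tilde L(a_1))\nu(a_2)+((L-R)(a_2)\otimes\mathrm{id})\vartheta^+(a_1)$; 7. $\nu(a_1\ast a_2+a_2\ast a_1)=(\mathrm{id}\otimes(\tilde L+\tilde R)(a_1))\nu(a_2)+((\tilde L+\tilde R)(a_1)\otimes\mathrm{id})\tau\nu(a_2)+(\mathrm{id}\otimes(L-R)(a_2))\vartheta(a_1)+((L-R)(a_2)\otimes\mathrm{id})\tau\vartheta(a_1)$. For $s\in A\otimes A$: $\nu_s(a)=(\mathrm{id}\otimes R(a)+(R-L)(a)\otimes\mathrm{id})(s)$, $\vartheta_s(a)=((\tilde L+\tilde R)(a)\otimes\mathrm{id}-\mathrm{id}\otimes\tilde R(a))(s)$; $s$ is DP-invariant if $\nu_s=\vartheta_s=0$. For $s=\sum_i x_i\otimes y_i$ the DPYBE is the pair $\sum_{i,j}\big(x_i\otimes(y_i\circ x_j)\otimes y_j-x_i\otimes x_j\otimes(y_i\circ y_j)+(x_i\circ x_j)\otimes y_i\otimes y_j-(x_i\circ x_j)\otimes y_j\otimes y_i\big)=0$, $\sum_{i,j}\big((x_i\ast x_j)\otimes y_i\otimes y_j-x_i\otimes(y_i\ast x_j)\otimes y_j-x_j\otimes(x_i\ast y_j)\otimes y_i+x_j\otimes x_i\otimes(y_i\ast y_j)\big)=0$. A DPP bialgebra is factorizable if $\nu=\nu_s$, $\vartheta=\vartheta_s$ for some solution $s\in A\otimes A$ of the DPYBE such that $s-\tau(s)$ is DP-invariant and $s^\sharp-\tau(s)^\sharp:A^*\to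 A$ is a linear isomorphism. *)

theory Defs
  imports Complex_Main "HOL-Library.Function_Algebras"
begin

text \<open>
  A finite-dimensional vector space is a type \<open>'v\<close> of class \<^class>\<open>ab_group_add\<close> with a scalar
  multiplication by a field of characteristic \<open>0\<close>. Sums, differences and \<open>0\<close> of functions are
  pointwise, as in HOL-Library.Function_Algebras.
\<close>

locale fd_space = vector_space scale
  for scale :: "'k::field_char_0 \<Rightarrow> 'v::ab_group_add \<Rightarrow> 'v" +
  assumes finite_dim: "\<exists>Basis. finite_dimensional_vector_space scale Basis"

definition bilinear_op ::
  "('k::field \<Rightarrow> 'a::ab_group_add \<Rightarrow> 'a) \<Rightarrow> ('k \<Rightarrow> 'b::ab_group_add \<Rightarrow> 'b) \<Rightarrow>
   ('k \<Rightarrow> 'c::ab_group_add \<Rightarrow> 'c) \<Rightarrow> ('a \<Rightarrow> 'b \<Rightarrow> 'c) \<Rightarrow> bool" where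
  "bilinear_op sA sB sC f \<longleftrightarrow>
     (\<forall>x. Vector_Spaces.linear sB sC (\<lambda>y. f x y)) \<and> (\<forall>y. Vector_Spaces.linear sA sC (\<lambda>x. f x y))"

definition dual :: "('k::field \<Rightarrow> 'v::ab_group_add \<Rightarrow> 'v) \<Rightarrow> ('v \<Rightarrow> 'k) set" where
  "dual s = {\<xi>. Vector_Spaces.linear s (*) \<xi>}"


section \<open>Tensor powers of a space\<close>

text \<open>
  The spaces \<open>V \<otimes> V\<close> and \<open>V \<otimes> V \<otimes> V\<close> are realised inside the functions of two, respectively three,
  functionals on \<open>V\<close>: a tensor \<open>t\<close> is identified with \<open>\<lambda>\<xi> \<eta>. \<langle>\<xi> \<otimes> \<eta>, t\<rangle>\<close>, and this function is set
  to \<open>0\<close> at arguments that are not linear. For finite-dimensional \<open>V\<close> the identification is faithful.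
\<close>

type_synonym ('v, 'k) ten2 = "('v \<Rightarrow> 'k) \<Rightarrow> ('v \<Rightarrow> 'k) \<Rightarrow> 'k"
type_synonym ('v, 'k) ten3 = "('v \<Rightarrow> 'k) \<Rightarrow> ('v \<Rightarrow> 'k) \<Rightarrow> ('v \<Rightarrow> 'k) \<Rightarrow> 'k"

definition tens2 ::
  "('k::field \<Rightarrow> 'v::ab_group_add \<Rightarrow> 'v) \<Rightarrow> 'v \<Rightarrow> 'v \<Rightarrow> ('v, 'k) ten2" where
  "tens2 s x y = (\<lambda>\<xi> \<eta>. if \<xi> \<in> dual s \<and> \<eta> \<in> dual s then \<xi> x * \<eta> y else 0)"

definition tens3 ::
  "('k::field \<Rightarrow> 'v::ab_group_add \<Rightarrow> 'v) \<Rightarrow> 'v \<Rightarrow> 'v \<Rightarrow> 'v \<Rightarrow> ('v, 'k) ten3" where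
  "tens3 s x y z = (\<lambda>\<xi> \<eta> \<zeta>. if \<xi> \<in> dual s \<and> \<eta> \<in> dual s \<and> \<zeta> \<in> dual s then \<xi> x * \<eta> y * \<zeta> z else 0)"

definition Tens2 :: "('k::field \<Rightarrow> 'v::ab_group_add \<Rightarrow> 'v) \<Rightarrow> ('v, 'k) ten2 set" where
  "Tens2 s = {t. \<exists>(n::nat) x y. t = (\<Sum>i<n. tens2 s (x i) (y i))}"

definition scale2 :: "'k::field \<Rightarrow> ('v, 'k) ten2 \<Rightarrow> ('v, 'k) ten2" where
  "scale2 c t = (\<lambda>\<xi> \<eta>. c * t \<xi> \<eta>)"

definition flip :: "('v, 'k) ten2 \<Rightarrow> ('v, 'k) ten2" where
  "flip t = (\<lambda>\<xi> \<eta>. t \<eta> \<xi>)"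

text \<open>The map \<open>\<tau> \<otimes> id\<close>.\<close>

definition flip12 :: "('v, 'k) ten3 \<Rightarrow> ('v, 'k) ten3" where
  "flip12 t = (\<lambda>\<xi> \<eta> \<zeta>. t \<eta> \<xi> \<zeta>)"

text \<open>The map \<open>f \<otimes> g\<close> for linear endomorphisms \<open>f\<close> and \<open>g\<close>; see the lemma \<open>tmap_tens2\<close>.\<close>

definition tmap ::
  "('k::field \<Rightarrow> 'v::ab_group_add \<Rightarrow> 'v) \<Rightarrow> ('v \<Rightarrow> 'v) \<Rightarrow> ('v \<Rightarrow> 'v) \<Rightarrow> ('v, 'k) ten2 \<Rightarrow> ('v, 'k) ten2"
  where
  "tmap s f g t = (\<lambda>\<xi> \<eta>. if \<xi> \<in> dual s \<and> \<eta> \<in> dual s then t (\<lambda>x. \<xi> (f x)) (\<lambda>y. \<eta> (g y)) else 0)"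

text \<open>
  The maps \<open>D \<otimes> id\<close> and \<open>id \<otimes> D\<close> from \<open>V \<otimes> V\<close> to \<open>V \<otimes> V \<otimes> V\<close>, for linear \<open>D : V \<rightarrow> V \<otimes> V\<close>;
  see the lemmas \<open>cop_id_tens2\<close> and \<open>id_cop_tens2\<close>.
\<close>

definition cop_id :: "('v \<Rightarrow> ('v, 'k) ten2) \<Rightarrow> ('v, 'k) ten2 \<Rightarrow> ('v, 'k) ten3" where
  "cop_id D t = (\<lambda>\<xi> \<eta> \<zeta>. t (\<lambda>x. D x \<xi> \<eta>) \<zeta>)"

definition id_cop :: "('v \<Rightarrow> ('v, 'k) ten2) \<Rightarrow> ('v, 'k) ten2 \<Rightarrow> ('v, 'k) ten3" where
  "id_cop D t = (\<lambda>\<xi> \<eta> \<zeta>. t \<xi> (\<lambda>y. D y \<eta> \<zeta>))"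

definition coproduct ::
  "('k::field \<Rightarrow> 'v::ab_group_add \<Rightarrow> 'v) \<Rightarrow> ('v \<Rightarrow> ('v, 'k) ten2) \<Rightarrow> bool" where
  "coproduct s D \<longleftrightarrow> Vector_Spaces.linear s scale2 D \<and> range D \<subseteq> Tens2 s"

text \<open>\<open>t\<^sup>\<sharp>(\<xi>)\<close> is the vector with \<open>\<langle>\<eta>, t\<^sup>\<sharp>(\<xi>)\<rangle> = \<langle>\<xi> \<otimes> \<eta>, t\<rangle>\<close> for all \<open>\<eta>\<close>.\<close>

definition sharp ::
  "('k::field \<Rightarrow> 'v::ab_group_add \<Rightarrow> 'v) \<Rightarrow> ('v, 'k) ten2 \<Rightarrow> ('v \<Rightarrow> 'k) \<Rightarrow> 'v" where
  "sharp s t \<xi> = (THE v. \<forall>\<eta>\<in>dual s. \<eta> v = t \<xi> \<eta>)"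

definition dual_iso ::
  "('k::field \<Rightarrow> 'v::ab_group_add \<Rightarrow> 'v) \<Rightarrow> (('v \<Rightarrow> 'k) \<Rightarrow> 'v) \<Rightarrow> bool" where
  "dual_iso s F \<longleftrightarrow>
     (\<forall>\<xi>\<in>dual s. \<forall>\<eta>\<in>dual s. F (\<xi> + \<eta>) = F \<xi> + F \<eta>) \<and>
     (\<forall>c. \<forall>\<xi>\<in>dual s. F (\<lambda>x. c * \<xi> x) = s c (F \<xi>)) \<and>
     bij_betw F (dual s) UNIV"

lemma linear_comp_dual:
  assumes "Vector_Spaces.linear s s f" "\<xi> \<in> dual s"
  shows "(\<lambda>x. \<xi> (f x)) \<in> dual s"
  using Vector_Spaces.linear_compose[of s s f "(*)" \<xi>] assms by (simp add: dual_def o_def)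

lemma tmap_tens2:
  assumes "Vector_Spaces.linear s s f" "Vector_Spaces.linear s s g"
  shows "tmap s f g (tens2 s x y) = tens2 s (f x) (g y)"
  using linear_comp_dual[OF assms(1)] linear_comp_dual[OF assms(2)]
  by (auto simp: tmap_def tens2_def fun_eq_iff)

lemma flip_tens2: "flip (tens2 s x y) = tens2 s y x"
  by (auto simp: flip_def tens2_def fun_eq_iff)

lemma coproduct_dual:
  assumes "coproduct s D"
  shows "(\<lambda>x. D x \<xi> \<eta>) \<in> dual s"
proof -
  interpret D: Vector_Spaces.linear s scale2 D
    using assms by (simp add: coproduct_def)
  have "vector_space ((*) :: 'a \<Rightarrow> 'a \<Rightarrow> 'a)"
    by unfold_locales (auto simp: algebra_simps)
  then show ?thesis
    unfolding dual_def mem_Collect_eq Vector_Spaces.linear_iff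
    using D.vs1.vector_space_axioms by (simp add: D.add D.scale scale2_def)
qed

lemma cop_id_tens2:
  assumes "coproduct s D" "D x = (\<Sum>i<n. tens2 s (a i) (b i))"
  shows "cop_id D (tens2 s x y) = (\<Sum>i<(n::nat). tens3 s (a i) (b i) y)"
proof -
  have s1: "sum f {..<n} \<xi> = (\<Sum>i<n. f i \<xi>)" for f :: "nat \<Rightarrow> 'c \<Rightarrow> 'd::comm_monoid_add" and \<xi> and n :: nat
    by (induction n) auto
  show ?thesis
    using coproduct_dual[OF assms(1)]
    by (auto simp: cop_id_def tens2_def tens3_def fun_eq_iff assms(2) s1 sum_distrib_right intro!: sum.cong)
qed

lemma id_cop_tens2:
  assumes "coproduct s D" "D y = (\<Sum>i<n. tens2 s (a i) (b i))"
  shows "id_cop D (tens2 s x y) = (\<Sum>i<(n::nat). tens3 s x (a i) (b i))"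
proof -
  have s1: "sum f {..<n} \<xi> = (\<Sum>i<n. f i \<xi>)" for f :: "nat \<Rightarrow> 'c \<Rightarrow> 'd::comm_monoid_add" and \<xi> and n :: nat
    by (induction n) auto
  show ?thesis
    using coproduct_dual[OF assms(1)]
    by (auto simp: id_cop_def tens2_def tens3_def fun_eq_iff assms(2) s1 sum_distrib_left mult.assoc intro!: sum.cong)
qed

abbreviation (in fd_space) tmap_op (infix "\<otimes>\<^sub>m" 75) where
  "f \<otimes>\<^sub>m g \<equiv> tmap scale f g"


section \<open>The tensor product of two spaces\<close>

text \<open>
  The underlying space of \<open>P \<otimes> B\<close> has to be a type, so it is any space with a universal bilinear map
  from \<open>P \<times> B\<close>. Because the pure tensors span, it is enough to demand the factorisation of
  scalar-valued bilinear maps, and the factorisation is unique.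
\<close>

locale tensor_product = V: vector_space sV + W: vector_space sW + T: vector_space sT
  for sV :: "'k::field_char_0 \<Rightarrow> 'v::ab_group_add \<Rightarrow> 'v"
  and sW :: "'k \<Rightarrow> 'w::ab_group_add \<Rightarrow> 'w"
  and sT :: "'k \<Rightarrow> 't::ab_group_add \<Rightarrow> 't" +
  fixes ten :: "'v \<Rightarrow> 'w \<Rightarrow> 't"
  assumes bilinear: "bilinear_op sV sW sT ten"
  and spanning: "\<exists>(n::nat) v w. t = (\<Sum>i<n. ten (v i) (w i))"
  and universal: "bilinear_op sV sW (*) \<beta> \<Longrightarrow>
        \<exists>f. Vector_Spaces.linear sT (*) f \<and> (\<forall>v w. f (ten v w) = \<beta> v w)"

text \<open>
  The bilinear map \<open>(p' \<otimes> p'') \<bullet> (b' \<otimes> b'') = (p' \<otimes> b') \<otimes> (p'' \<otimes> b'')\<close>. The result does not depend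
  on the decompositions of \<open>t\<close> and \<open>u\<close>, so \<open>THE\<close> applies.
\<close>

definition bullet ::
  "('k::field \<Rightarrow> 'p::ab_group_add \<Rightarrow> 'p) \<Rightarrow> ('k \<Rightarrow> 'b::ab_group_add \<Rightarrow> 'b) \<Rightarrow>
   ('k \<Rightarrow> 'a::ab_group_add \<Rightarrow> 'a) \<Rightarrow> ('p \<Rightarrow> 'b \<Rightarrow> 'a) \<Rightarrow>
   ('p, 'k) ten2 \<Rightarrow> ('b, 'k) ten2 \<Rightarrow> ('a, 'k) ten2" where
  "bullet sP sB sA ten t u =
     (THE w. \<exists>(m::nat) (n::nat) p' p'' b' b''.
        t = (\<Sum>i<m. tens2 sP (p' i) (p'' i)) \<and>
        u = (\<Sum>j<n. tens2 sB (b' j) (b'' j)) \<and>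
        w = (\<Sum>i<m. \<Sum>j<n. tens2 sA (ten (p' i) (b' j)) (ten (p'' i) (b'' j))))"


section \<open>Poisson bialgebras\<close>

locale poisson_algebra = fd_space scale
  for scale :: "'k::field_char_0 \<Rightarrow> 'p::ab_group_add \<Rightarrow> 'p" +
  fixes mul :: "'p \<Rightarrow> 'p \<Rightarrow> 'p" (infixl "\<cdot>" 70)
  and brk :: "'p \<Rightarrow> 'p \<Rightarrow> 'p"
  assumes mul_bilinear: "bilinear_op scale scale scale mul"
  and brk_bilinear: "bilinear_op scale scale scale brk"
  and mul_commute: "x \<cdot> y = y \<cdot> x"
  and mul_assoc: "(x \<cdot> y) \<cdot> z = x \<cdot> (y \<cdot> z)"
  and brk_alternating: "brk x x = 0"
  and brk_jacobi: "brk x (brk y z) + brk y (brk z x) + brk z (brk x y) = 0"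
  and brk_derivation: "brk x (y \<cdot> z) = brk x y \<cdot> z + y \<cdot> brk x z"

locale poisson_coalgebra = fd_space scale
  for scale :: "'k::field_char_0 \<Rightarrow> 'p::ab_group_add \<Rightarrow> 'p" +
  fixes \<Delta> \<delta> :: "'p \<Rightarrow> ('p, 'k) ten2"
  assumes Delta_coproduct: "coproduct scale \<Delta>"
  and delta_coproduct: "coproduct scale \<delta>"
  and Delta_cocommutative: "flip (\<Delta> p) = \<Delta> p"
  and Delta_coassociative: "cop_id \<Delta> (\<Delta> p) = id_cop \<Delta> (\<Delta> p)"
  and delta_skew: "flip (\<delta> p) = - \<delta> p"
  and delta_cojacobi: "id_cop \<delta> (\<delta> p) - flip12 (id_cop \<delta> (\<delta> p)) = cop_id \<delta> (\<delta> p)"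
  and coderivation: "id_cop \<Delta> (\<delta> p) = cop_id \<delta> (\<Delta> p) + flip12 (id_cop \<delta> (\<Delta> p))"

locale poisson_bialgebra =
  poisson_algebra scale mul brk + poisson_coalgebra scale \<Delta> \<delta>
  for scale :: "'k::field_char_0 \<Rightarrow> 'p::ab_group_add \<Rightarrow> 'p"
  and mul (infixl "\<cdot>" 70) and brk and \<Delta> \<delta> +
  assumes Delta_mul:
    "\<Delta> (p \<cdot> q) = (mul q \<otimes>\<^sub>m id) (\<Delta> p) + (id \<otimes>\<^sub>m mul p) (\<Delta> q)"
  and delta_brk:
    "\<delta> (brk p q) = (brk p \<otimes>\<^sub>m id + id \<otimes>\<^sub>m brk p) (\<delta> q) - (brk q \<otimes>\<^sub>m id + id \<otimes>\<^sub>m brk q) (\<delta> p)"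
  and Delta_brk:
    "\<Delta> (brk p q) = (brk p \<otimes>\<^sub>m id + id \<otimes>\<^sub>m brk p) (\<Delta> q) + (mul q \<otimes>\<^sub>m id - id \<otimes>\<^sub>m mul q) (\<delta> p)"
  and delta_mul:
    "\<delta> (p \<cdot> q) = (mul p \<otimes>\<^sub>m id) (\<delta> q) + (mul q \<otimes>\<^sub>m id) (\<delta> p) +
       (id \<otimes>\<^sub>m brk p) (\<Delta> q) + (id \<otimes>\<^sub>m brk q) (\<Delta> p)"

context
  fixes s :: "'k::field \<Rightarrow> 'p::ab_group_add \<Rightarrow> 'p"
  and mul brk :: "'p \<Rightarrow> 'p \<Rightarrow> 'p"
begin

definition Delta_of :: "('p, 'k) ten2 \<Rightarrow> 'p \<Rightarrow> ('p, 'k) ten2" where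
  "Delta_of r p = (tmap s id (mul p) - tmap s (mul p) id) r"

definition delta_of :: "('p, 'k) ten2 \<Rightarrow> 'p \<Rightarrow> ('p, 'k) ten2" where
  "delta_of r p = (tmap s id (brk p) + tmap s (brk p) id) r"

definition poi_invariant :: "('p, 'k) ten2 \<Rightarrow> bool" where
  "poi_invariant r \<longleftrightarrow> Delta_of r = 0 \<and> delta_of r = 0"

text \<open>
  By multilinearity, the two expressions depend only on \<open>r\<close> and not on its decomposition. The same
  remark applies to the DPYBE below.
\<close>

definition poi_ybe :: "('p, 'k) ten2 \<Rightarrow> bool" where
  "poi_ybe r \<longleftrightarrow> (\<exists>(n::nat) x y. r = (\<Sum>i<n. tens2 s (x i) (y i)) \<and>
     (\<Sum>i<n. \<Sum>j<n. tens3 s (mul (x i) (x j)) (y i) (y j)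
        + tens3 s (x i) (x j) (mul (y i) (y j))
        - tens3 s (x j) (mul (x i) (y j)) (y i)) = 0 \<and>
     (\<Sum>i<n. \<Sum>j<n. tens3 s (brk (x i) (x j)) (y i) (y j)
        + tens3 s (x i) (x j) (brk (y i) (y j))
        + tens3 s (x i) (brk (y i) (x j)) (y j)) = 0)"

end

definition factorizable_poisson_bialgebra ::
  "('k::field_char_0 \<Rightarrow> 'p::ab_group_add \<Rightarrow> 'p) \<Rightarrow> ('p \<Rightarrow> 'p \<Rightarrow> 'p) \<Rightarrow> ('p \<Rightarrow> 'p \<Rightarrow> 'p) \<Rightarrow>
   ('p \<Rightarrow> ('p, 'k) ten2) \<Rightarrow> ('p \<Rightarrow> ('p, 'k) ten2) \<Rightarrow> bool" where
  "factorizable_poisson_bialgebra s mul brk \<Delta> \<delta> \<longleftrightarrow>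
     poisson_bialgebra s mul brk \<Delta> \<delta> \<and>
     (\<exists>r\<in>Tens2 s. poi_ybe s mul brk r \<and>
        \<Delta> = Delta_of s mul r \<and> \<delta> = delta_of s brk r \<and>
        poi_invariant s mul brk (r + flip r) \<and>
        dual_iso s (\<lambda>\<xi>. sharp s r \<xi> + sharp s (flip r) \<xi>))"


section \<open>Quadratic perm algebras\<close>

locale perm_algebra = fd_space scale
  for scale :: "'k::field_char_0 \<Rightarrow> 'b::ab_group_add \<Rightarrow> 'b" +
  fixes circ :: "'b \<Rightarrow> 'b \<Rightarrow> 'b" (infixl "\<odot>" 70)
  assumes circ_bilinear: "bilinear_op scale scale scale circ"
  and circ_assoc: "x \<odot> (y \<odot> z) = (x \<odot> y) \<odot> z"
  and circ_left_commute: "(x \<odot> y) \<odot> z = (y \<odot> x) \<odot> z"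

locale quadratic_perm_algebra = perm_algebra scale circ
  for scale :: "'k::field_char_0 \<Rightarrow> 'b::ab_group_add \<Rightarrow> 'b"
  and circ (infixl "\<odot>" 70) +
  fixes \<omega> :: "'b \<Rightarrow> 'b \<Rightarrow> 'k"
  assumes form_bilinear: "bilinear_op scale scale (*) \<omega>"
  and form_skew: "\<omega> x y = - \<omega> y x"
  and form_nondegenerate: "(\<And>y. \<omega> x y = 0) \<Longrightarrow> x = 0"
  and form_invariant: "\<omega> (x \<odot> y) z = \<omega> x (y \<odot> z - z \<odot> y)"

text \<open>
  For \<open>t \<in> B \<otimes> B\<close>, the scalar \<open>(\<omega> \<otimes> \<omega>)(t, b \<otimes> b')\<close> is the value of \<open>t\<close> at the functionals
  \<open>\<omega>(-, b)\<close> and \<open>\<omega>(-, b')\<close>.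
\<close>

definition nu_form ::
  "('k::field \<Rightarrow> 'b::ab_group_add \<Rightarrow> 'b) \<Rightarrow> ('b \<Rightarrow> 'b \<Rightarrow> 'b) \<Rightarrow> ('b \<Rightarrow> 'b \<Rightarrow> 'k) \<Rightarrow>
   'b \<Rightarrow> ('b, 'k) ten2" where
  "nu_form s circ \<omega> b =
     (THE t. t \<in> Tens2 s \<and> (\<forall>b' b''. t (\<lambda>x. \<omega> x b') (\<lambda>y. \<omega> y b'') = - \<omega> b (circ b' b'')))"


section \<open>DPP bialgebras\<close>

locale dpp_algebra = perm_algebra scale circ
  for scale :: "'k::field_char_0 \<Rightarrow> 'a::ab_group_add \<Rightarrow> 'a"
  and circ (infixl "\<odot>" 70) +
  fixes ast :: "'a \<Rightarrow> 'a \<Rightarrow> 'a" (infixl "\<star>" 70)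
  assumes ast_bilinear: "bilinear_op scale scale scale ast"
  and ast_leibniz: "x \<star> (y \<star> z) = (x \<star> y) \<star> z + y \<star> (x \<star> z)"
  and circ_ast: "(x \<odot> y) \<star> z = x \<odot> (y \<star> z) + y \<odot> (x \<star> z)"
  and ast_circ: "(x \<star> y) \<odot> z = x \<star> (y \<odot> z) - y \<odot> (x \<star> z)"
  and ast_circ_skew: "(x \<star> y) \<odot> z = - ((y \<star> x) \<odot> z)"
begin

abbreviation L :: "'a \<Rightarrow> 'a \<Rightarrow> 'a" where "L a \<equiv> \<lambda>b. a \<odot> b"
abbreviation R :: "'a \<Rightarrow> 'a \<Rightarrow> 'a" where "R a \<equiv> \<lambda>b. b \<odot> a"
abbreviation Lt :: "'a \<Rightarrow> 'a \<Rightarrow> 'a" where "Lt a \<equiv> \<lambda>b. a \<star> b"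
abbreviation Rt :: "'a \<Rightarrow> 'a \<Rightarrow> 'a" where "Rt a \<equiv> \<lambda>b. b \<star> a"

end

locale dpp_coalgebra = fd_space scale
  for scale :: "'k::field_char_0 \<Rightarrow> 'a::ab_group_add \<Rightarrow> 'a" +
  fixes \<nu> \<theta> :: "'a \<Rightarrow> ('a, 'k) ten2"
  assumes nu_coproduct: "coproduct scale \<nu>"
  and theta_coproduct: "coproduct scale \<theta>"
  and nu_coassociative: "cop_id \<nu> (\<nu> a) = id_cop \<nu> (\<nu> a)"
  and nu_left_cocommute: "id_cop \<nu> (\<nu> a) = flip12 (id_cop \<nu> (\<nu> a))"
  and theta_coleibniz: "id_cop \<theta> (\<theta> a) = cop_id \<theta> (\<theta> a) + flip12 (id_cop \<theta> (\<theta> a))"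
  and id_nu_theta: "id_cop \<nu> (\<theta> a) = cop_id \<theta> (\<nu> a) + flip12 (id_cop \<theta> (\<nu> a))"
  and nu_id_theta: "cop_id \<nu> (\<theta> a) = id_cop \<theta> (\<nu> a) + flip12 (id_cop \<theta> (\<nu> a))"
  and theta_id_nu: "cop_id \<theta> (\<nu> a) = - flip12 (cop_id \<theta> (\<nu> a))"
begin

abbreviation num :: "'a \<Rightarrow> ('a, 'k) ten2" where "num a \<equiv> \<nu> a - flip (\<nu> a)"
abbreviation thp :: "'a \<Rightarrow> ('a, 'k) ten2" where "thp a \<equiv> \<theta> a + flip (\<theta> a)"

end

locale dpp_bialgebra =
  dpp_algebra scale circ ast + dpp_coalgebra scale \<nu> \<theta>
  for scale :: "'k::field_char_0 \<Rightarrow> 'a::ab_group_add \<Rightarrow> 'a"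
  and circ (infixl "\<odot>" 70) and ast (infixl "\<star>" 70) and \<nu> \<theta> +
  assumes perm_bialgebra1:
    "(R a \<otimes>\<^sub>m id) (\<nu> b) = flip ((R b \<otimes>\<^sub>m id) (\<nu> a))"
  and perm_bialgebra2:
    "\<nu> (a \<odot> b) = ((L a - R a) \<otimes>\<^sub>m id) (\<nu> b) + (id \<otimes>\<^sub>m R b) (\<nu> a)"
  and perm_bialgebra3:
    "\<nu> (a \<odot> b) = (id \<otimes>\<^sub>m L a) (\<nu> b) + ((L b - R b) \<otimes>\<^sub>m id) (num a)"
  and leibniz_bialgebra1:
    "flip ((Rt b \<otimes>\<^sub>m id) (\<theta> a)) = (Rt a \<otimes>\<^sub>m id) (\<theta> b)"
  and leibniz_bialgebra2:
    "\<theta> (a \<star> b) = (id \<otimes>\<^sub>m Rt b - (Lt b + Rt b) \<otimes>\<^sub>m id) (thp a) + (id \<otimes>\<^sub>m Lt a + Lt a \<otimes>\<^sub>m id) (\<theta> b)"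
  and dpp_bialgebra1:
    "\<nu> (a \<star> b) = (id \<otimes>\<^sub>m Lt a + Lt a \<otimes>\<^sub>m id) (\<nu> b) + ((L b - R b) \<otimes>\<^sub>m id - id \<otimes>\<^sub>m R b) (thp a)"
  and dpp_bialgebra2:
    "\<theta> (a \<odot> b) = (id \<otimes>\<^sub>m L a) (\<theta> b) + (id \<otimes>\<^sub>m R b) (\<theta> a)
       - ((Lt a + Rt a) \<otimes>\<^sub>m id) (\<nu> b) - ((Lt b + Rt b) \<otimes>\<^sub>m id) (num a)"
  and dpp_bialgebra3:
    "(id \<otimes>\<^sub>m Rt a) (flip (\<nu> b)) = - (R b \<otimes>\<^sub>m id) (\<theta> a)"
  and dpp_bialgebra4:
    "\<nu> (a \<star> b) = (id \<otimes>\<^sub>m L a - L a \<otimes>\<^sub>m id) (\<theta> b) + (id \<otimes>\<^sub>m Rt b - (Lt b + Rt b) \<otimes>\<^sub>m id) (num a)"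
  and dpp_bialgebra5:
    "thp (a \<odot> b) = (id \<otimes>\<^sub>m L a) (thp b) + (id \<otimes>\<^sub>m L b) (thp a)
       - (Lt a \<otimes>\<^sub>m id) (num b) - (Lt b \<otimes>\<^sub>m id) (num a)"
  and dpp_bialgebra6:
    "\<theta> (a \<odot> b) = (L a \<otimes>\<^sub>m id) (\<theta> b) - (id \<otimes>\<^sub>m Rt b) (num a)
       + (id \<otimes>\<^sub>m Lt a) (\<nu> b) + ((L b - R b) \<otimes>\<^sub>m id) (thp a)"
  and dpp_bialgebra7:
    "\<nu> (a \<star> b + b \<star> a) = (id \<otimes>\<^sub>m (Lt a + Rt a)) (\<nu> b) + ((Lt a + Rt a) \<otimes>\<^sub>m id) (flip (\<nu> b))
       + (id \<otimes>\<^sub>m (L b - R b)) (\<theta> a) + ((L b - R b) \<otimes>\<^sub>m id) (flip (\<theta> a))"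

context
  fixes s :: "'k::field \<Rightarrow> 'a::ab_group_add \<Rightarrow> 'a"
  and circ ast :: "'a \<Rightarrow> 'a \<Rightarrow> 'a"
begin

definition nu_of :: "('a, 'k) ten2 \<Rightarrow> 'a \<Rightarrow> ('a, 'k) ten2" where
  "nu_of t a = (tmap s id (\<lambda>b. circ b a) + tmap s (\<lambda>b. circ b a - circ a b) id) t"

definition theta_of :: "('a, 'k) ten2 \<Rightarrow> 'a \<Rightarrow> ('a, 'k) ten2" where
  "theta_of t a = (tmap s (\<lambda>b. ast a b + ast b a) id - tmap s id (\<lambda>b. ast b a)) t"

definition dp_invariant :: "('a, 'k) ten2 \<Rightarrow> bool" where
  "dp_invariant t \<longleftrightarrow> nu_of t = 0 \<and> theta_of t = 0"

definition dp_ybe :: "('a, 'k) ten2 \<Rightarrow> bool" where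
  "dp_ybe t \<longleftrightarrow> (\<exists>(n::nat) x y. t = (\<Sum>i<n. tens2 s (x i) (y i)) \<and>
     (\<Sum>i<n. \<Sum>j<n. tens3 s (x i) (circ (y i) (x j)) (y j)
        - tens3 s (x i) (x j) (circ (y i) (y j))
        + tens3 s (circ (x i) (x j)) (y i) (y j)
        - tens3 s (circ (x i) (x j)) (y j) (y i)) = 0 \<and>
     (\<Sum>i<n. \<Sum>j<n. tens3 s (ast (x i) (x j)) (y i) (y j)
        - tens3 s (x i) (ast (y i) (x j)) (y j)
        - tens3 s (x j) (ast (x i) (y j)) (y i)
        + tens3 s (x j) (x i) (ast (y i) (y j))) = 0)"

end

definition factorizable_dpp_bialgebra ::
  "('k::field_char_0 \<Rightarrow> 'a::ab_group_add \<Rightarrow> 'a) \<Rightarrow> ('a \<Rightarrow> 'a \<Rightarrow> 'a) \<Rightarrow> ('a \<Rightarrow> 'a \<Rightarrow> 'a) \<Rightarrow>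
   ('a \<Rightarrow> ('a, 'k) ten2) \<Rightarrow> ('a \<Rightarrow> ('a, 'k) ten2) \<Rightarrow> bool" where
  "factorizable_dpp_bialgebra s circ ast \<nu> \<theta> \<longleftrightarrow>
     dpp_bialgebra s circ ast \<nu> \<theta> \<and>
     (\<exists>t\<in>Tens2 s. dp_ybe s circ ast t \<and>
        \<nu> = nu_of s circ t \<and> \<theta> = theta_of s ast t \<and>
        dp_invariant s circ ast (t - flip t) \<and>
        dual_iso s (\<lambda>\<xi>. sharp s t \<xi> - sharp s (flip t) \<xi>))"

end

theory Submission
  imports Defs
begin

text \<open>
  The functionals \<open>[f, c] = f \<otimes> \<omega>(-, c)\<close> with \<open>f \<in> P\<^sup>*\<close> and \<open>c \<in> B\<close> span the dual of \<open>P \<otimes> B\<close>, and on them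
  \<open>\<nu>(p \<otimes> b)\<close> takes the value \<open>- \<Delta>(p)(f, g) \<omega>(b, c d)\<close>; similarly for \<open>\<theta>\<close>. With respect to \<open>\<omega>\<close> the adjoint
  of \<open>L\<close> is \<open>L\<close> and that of \<open>R\<close> is \<open>L - R\<close>, so every axiom, evaluated at pure tensors and at such
  functionals, becomes an identity between products of a Poisson quantity and one of the scalars
  \<open>\<omega>(x, y z w)\<close>, of which only three are independent. If \<open>r\<close> is the Poisson r-matrix and
  \<open>\<Sum> u\<^sub>k \<otimes> v\<^sub>k\<close> is the Casimir tensor of \<open>\<omega>\<close>, then \<open>s = \<Sum> (x\<^sub>i \<otimes> u\<^sub>k) \<otimes> (y\<^sub>i \<otimes> v\<^sub>k)\<close> satisfies
  \<open>s([f, c], [g, d]) = - r(f, g) \<omega>(c, d)\<close>. As \<open>\<omega>\<close> is skew-symmetric, \<open>s - \<tau>(s)\<close> corresponds in the same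
  way to \<open>r + \<tau>(r)\<close>, and both equations of the DPYBE are \<open>\<omega>(c d, e)\<close> times one of the PoiYBE.
\<close>

section \<open>Duals and tensors\<close>

lemma sum_fun_apply: "sum f I x = (\<Sum>i\<in>I. f i x)"
  for f :: "'i \<Rightarrow> 'x \<Rightarrow> 'y::comm_monoid_add"
  by (induction I rule: infinite_finite_induct) auto

lemma vector_space_field: "vector_space ((*) :: 'k::field \<Rightarrow> 'k \<Rightarrow> 'k)"
  by unfold_locales (auto simp: algebra_simps)

lemma (in vector_space) dualI:
  assumes "\<And>x y. f (x + y) = f x + f y" "\<And>c x. f (scale c x) = c * f x"
  shows "f \<in> dual scale"
  using assms vector_space_axioms vector_space_field by (simp add: dual_def Vector_Spaces.linear_iff)

lemma dual_add: "\<xi> \<in> dual s \<Longrightarrow> \<xi> (x + y) = \<xi> x + \<xi> y"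
  by (simp add: dual_def Vector_Spaces.linear_iff)

lemma dual_scale: "\<xi> \<in> dual s \<Longrightarrow> \<xi> (s c x) = c * \<xi> x"
  by (simp add: dual_def Vector_Spaces.linear_iff)

lemma dual_zero: "\<xi> \<in> dual s \<Longrightarrow> \<xi> 0 = 0"
  using dual_add[of \<xi> s 0 0] by (metis add_cancel_right_right)

lemma dual_minus: "\<xi> \<in> dual s \<Longrightarrow> \<xi> (- x) = - \<xi> x"
  using dual_add[of \<xi> s x "- x"] dual_zero[of \<xi> s] by (simp add: eq_neg_iff_add_eq_0 add.commute)

lemma dual_diff: "\<xi> \<in> dual s \<Longrightarrow> \<xi> (x - y) = \<xi> x - \<xi> y"
  using dual_add[of \<xi> s x "- y"] by (simp add: dual_minus)

lemma dual_sum: "\<xi> \<in> dual s \<Longrightarrow> \<xi> (\<Sum>i\<in>I. f i) = (\<Sum>i\<in>I. \<xi> (f i))"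
  by (induction I rule: infinite_finite_induct) (auto simp: dual_add dual_zero)

context vector_space
begin

lemma dual_closed [simp, intro]:
  shows "0 \<in> dual scale"
    and "\<xi> \<in> dual scale \<Longrightarrow> \<eta> \<in> dual scale \<Longrightarrow> \<xi> + \<eta> \<in> dual scale"
    and "\<xi> \<in> dual scale \<Longrightarrow> \<eta> \<in> dual scale \<Longrightarrow> \<xi> - \<eta> \<in> dual scale"
    and "\<xi> \<in> dual scale \<Longrightarrow> - \<xi> \<in> dual scale"
    and "\<xi> \<in> dual scale \<Longrightarrow> (\<lambda>x. c * \<xi> x) \<in> dual scale"
  by (auto intro!: dualI simp: dual_add dual_scale algebra_simps)

text \<open>A nonzero vector is independent by itself, so some functional takes the value 1 on it.
  This yields uniqueness wherever a vector is described by its pairings, as in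
  \<open>sharp\<close>.\<close>

lemma dual_separates:
  assumes "\<And>\<xi>. \<xi> \<in> dual scale \<Longrightarrow> \<xi> v = 0"
  shows "v = 0"
proof (rule ccontr)
  assume "v \<noteq> 0"
  then have "independent {v}" by simp
  interpret F: vector_space "(*) :: 'a \<Rightarrow> 'a \<Rightarrow> 'a" by (rule vector_space_field)
  interpret vector_space_pair scale "(*) :: 'a \<Rightarrow> 'a \<Rightarrow> 'a" ..
  obtain g where "Vector_Spaces.linear scale (*) g" "g v = 1"
    using linear_independent_extend[OF \<open>independent {v}\<close>, of "\<lambda>_. 1"] by auto
  then show False using assms[of g] by (simp add: dual_def)
qed

lemma dual_separates_eq:
  assumes "\<And>\<xi>. \<xi> \<in> dual scale \<Longrightarrow> \<xi> v = \<xi> w"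
  shows "v = w"
  using dual_separates[of "v - w"] assms by (simp add: dual_diff)

lemma bilinear_opI:
  assumes "\<And>x y y'. f x (y + y') = f x y + f x y'" "\<And>x x' y. f (x + x') y = f x y + f x' y"
    and "\<And>c x y. f x (sB c y) = scale c (f x y)" "\<And>c x y. f (sA c x) y = scale c (f x y)"
    and "vector_space sA" "vector_space sB"
  shows "bilinear_op sA sB scale f"
  using assms vector_space_axioms by (simp add: bilinear_op_def Vector_Spaces.linear_iff)

end

lemma bilinear_op_simps:
  assumes "bilinear_op sA sB sC f"
  shows "f (x + x') y = f x y + f x' y" "f x (y + y') = f x y + f x y'"
    and "f (sA c x) y = sC c (f x y)" "f x (sB c y) = sC c (f x y)"
  using assms by (auto simp: bilinear_op_def Vector_Spaces.linear_iff)

lemma bilinear_op_zero: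
  assumes "bilinear_op sA sB sC f"
  shows "f 0 y = 0" "f x 0 = 0"
  using bilinear_op_simps(1)[OF assms, of 0 0 y] bilinear_op_simps(2)[OF assms, of x 0 0] by auto

lemma bilinear_op_minus:
  assumes "bilinear_op sA sB sC f"
  shows "f (- x) y = - f x y" "f x (- y) = - f x y"
  using bilinear_op_simps(1)[OF assms, of x "- x" y] bilinear_op_simps(2)[OF assms, of x y "- y"]
  by (auto simp: bilinear_op_zero[OF assms] eq_neg_iff_add_eq_0 add.commute)

lemma bilinear_op_diff:
  assumes "bilinear_op sA sB sC f"
  shows "f (x - x') y = f x y - f x' y" "f x (y - y') = f x y - f x y'"
  using bilinear_op_simps(1)[OF assms, of x "- x'" y] bilinear_op_simps(2)[OF assms, of x y "- y'"]
  by (auto simp: bilinear_op_minus[OF assms])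

lemma bilinear_op_sum:
  assumes "bilinear_op sA sB sC f"
  shows "f (\<Sum>i\<in>I. g i) y = (\<Sum>i\<in>I. f (g i) y)" "f x (\<Sum>i\<in>I. h i) = (\<Sum>i\<in>I. f x (h i))"
  by (induction I rule: infinite_finite_induct)
     (auto simp: bilinear_op_simps[OF assms] bilinear_op_zero[OF assms])

lemmas bilinear_op_rules =
  bilinear_op_simps bilinear_op_zero bilinear_op_minus bilinear_op_diff

lemma bilinear_op_linear:
  assumes "bilinear_op s s s f"
  shows "Vector_Spaces.linear s s (f x)" "Vector_Spaces.linear s s (\<lambda>y. f y x)"
  using assms by (auto simp: bilinear_op_def)

lemma bilinear_op_dual:
  assumes "bilinear_op sA sB (*) f"
  shows "f x \<in> dual sB" "(\<lambda>y. f y x) \<in> dual sA"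
  using assms by (auto simp: bilinear_op_def dual_def)

section \<open>Coordinates and finite spanning sets\<close>

context fd_space
begin

lemma coordinates:
  obtains E \<rho> where "finite E" "independent E" "span E = UNIV" "\<And>e. \<rho> e \<in> dual scale"
    "\<And>x. (\<Sum>e\<in>E. scale (\<rho> e x) e) = x"
proof -
  obtain E where "finite_dimensional_vector_space scale E" using finite_dim by auto
  then interpret E: finite_dimensional_vector_space scale E .
  show ?thesis
  proof
    show "finite E" "independent E" "span E = UNIV"
      by (rule E.finite_Basis E.independent_Basis E.span_Basis)+
    show "(\<lambda>v. representation E v e) \<in> dual scale" for e
      using linear_representation[OF E.independent_Basis E.span_Basis] by (simp add: dual_def)
    show "(\<Sum>e\<in>E. scale (representation E x e) e) = x" for x
      by (rule sum_representation_eq)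
         (auto simp: E.independent_Basis E.span_Basis E.finite_Basis)
  qed
qed

end

lemma fd_spaceI:
  fixes scale :: "'k::field_char_0 \<Rightarrow> 'v::ab_group_add \<Rightarrow> 'v"
  assumes "vector_space scale" "finite S" "module.span scale S = UNIV"
  shows "fd_space scale"
proof -
  interpret vector_space scale by fact
  obtain E where E: "E \<subseteq> S" "independent E" "S \<subseteq> span E"
    using maximal_independent_subset[of S] by blast
  then have "span E = UNIV" using assms(3) span_minimal[of S "span E"] by auto
  then have "finite_dimensional_vector_space scale E"
    using E assms(2) finite_subset[of E S] by unfold_locales auto
  then show ?thesis by unfold_locales auto
qed

section \<open>Tensors as bilinear functions on the dual\<close>

lemma tens2_apply [simp]:
  "\<xi> \<in> dual s \<Longrightarrow> \<eta> \<in> dual s \<Longrightarrow> tens2 s x y \<xi> \<eta> = \<xi> x * \<eta> y"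
  by (simp add: tens2_def)

lemma Tens2E:
  assumes "t \<in> Tens2 s"
  obtains n :: nat and x y where "t = (\<Sum>i<n. tens2 s (x i) (y i))"
  using assms by (auto simp: Tens2_def)

text \<open>\<open>Tens2\<close> speaks of index sets \<open>{..<n}\<close>; enumerating a finite
  set reduces any finite family to this form, in particular families over disjoint unions and
  products.\<close>

lemma sum_in_Tens2:
  assumes "finite I" shows "(\<Sum>i\<in>I. tens2 s (x i) (y i)) \<in> Tens2 s"
proof -
  obtain h where h: "bij_betw h {..<card I} I"
    using ex_bij_betw_nat_finite[OF assms] by (auto simp: lessThan_atLeast0)
  have "(\<Sum>i\<in>I. tens2 s (x i) (y i)) = (\<Sum>i<card I. tens2 s (x (h i)) (y (h i)))"
    by (rule sum.reindex_bij_betw[OF h, symmetric])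
  then show ?thesis unfolding Tens2_def mem_Collect_eq
    by (intro exI[of _ "card I"] exI[of _ "\<lambda>i. x (h i)"] exI[of _ "\<lambda>i. y (h i)"])
qed

lemma Tens2_add:
  assumes "t \<in> Tens2 s" "u \<in> Tens2 s" shows "t + u \<in> Tens2 s"
proof -
  obtain n x y where t: "t = (\<Sum>i<(n::nat). tens2 s (x i) (y i))" using assms by (auto elim: Tens2E)
  obtain m x' y' where u: "u = (\<Sum>i<(m::nat). tens2 s (x' i) (y' i))" using assms by (auto elim: Tens2E)
  have "t + u = (\<Sum>i \<in> {..<n} <+> {..<m}. tens2 s (case_sum x x' i) (case_sum y y' i))"
    by (simp add: t u sum.Plus)
  then show ?thesis by (simp add: sum_in_Tens2)
qed

lemma Tens2_outside: "t \<in> Tens2 s \<Longrightarrow> \<not> (\<xi> \<in> dual s \<and> \<eta> \<in> dual s) \<Longrightarrow> t \<xi> \<eta> = 0"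
  by (auto simp: sum_fun_apply tens2_def elim!: Tens2E)

text \<open>Additivity is restricted to the dual because of the default value 0: two nonlinear
  functions can have a linear sum, where the tensor may be nonzero.\<close>

lemma Tens2_bilinear:
  assumes "vector_space s" "t \<in> Tens2 s" "\<xi> \<in> dual s" "\<eta> \<in> dual s" "\<zeta> \<in> dual s"
  shows "t (\<xi> + \<eta>) \<zeta> = t \<xi> \<zeta> + t \<eta> \<zeta>" "t \<zeta> (\<xi> + \<eta>) = t \<zeta> \<xi> + t \<zeta> \<eta>"
    and "t (\<xi> - \<eta>) \<zeta> = t \<xi> \<zeta> - t \<eta> \<zeta>" "t \<zeta> (\<xi> - \<eta>) = t \<zeta> \<xi> - t \<zeta> \<eta>"
proof -
  interpret vector_space s by fact
  obtain n x y where t: "t = (\<Sum>i<(n::nat). tens2 s (x i) (y i))" using assms by (auto elim: Tens2E)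
  show "t (\<xi> + \<eta>) \<zeta> = t \<xi> \<zeta> + t \<eta> \<zeta>" "t \<zeta> (\<xi> + \<eta>) = t \<zeta> \<xi> + t \<zeta> \<eta>"
    "t (\<xi> - \<eta>) \<zeta> = t \<xi> \<zeta> - t \<eta> \<zeta>" "t \<zeta> (\<xi> - \<eta>) = t \<zeta> \<xi> - t \<zeta> \<eta>"
    using assms by (simp_all add: t sum_fun_apply algebra_simps sum.distrib sum_subtractf)
qed

lemma Tens2_homogeneous:
  assumes "vector_space s" "t \<in> Tens2 s" "\<xi> \<in> dual s" "\<zeta> \<in> dual s"
  shows "t (- \<xi>) \<zeta> = - t \<xi> \<zeta>" "t \<zeta> (- \<xi>) = - t \<zeta> \<xi>"
    and "t (\<lambda>x. c * \<xi> x) \<zeta> = c * t \<xi> \<zeta>" "t \<zeta> (\<lambda>x. c * \<xi> x) = c * t \<zeta> \<xi>"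
proof -
  interpret vector_space s by fact
  obtain n x y where t: "t = (\<Sum>i<(n::nat). tens2 s (x i) (y i))" using assms by (auto elim: Tens2E)
  show "t (- \<xi>) \<zeta> = - t \<xi> \<zeta>" "t \<zeta> (- \<xi>) = - t \<zeta> \<xi>"
    "t (\<lambda>x. c * \<xi> x) \<zeta> = c * t \<xi> \<zeta>" "t \<zeta> (\<lambda>x. c * \<xi> x) = c * t \<zeta> \<xi>"
    using assms by (simp_all add: t sum_fun_apply algebra_simps sum_distrib_left sum_negf)
qed

text \<open>The transpose of \<open>f\<close>. Being a constant, it can head the left-hand sides of
  rewrite rules, which a bare composition could not.\<close>

definition pull :: "('v \<Rightarrow> 'w) \<Rightarrow> ('w \<Rightarrow> 'k) \<Rightarrow> 'v \<Rightarrow> 'k" where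
  "pull f \<xi> = (\<lambda>x. \<xi> (f x))"

lemma tmap_apply:
  "tmap s f g t \<xi> \<eta> = (if \<xi> \<in> dual s \<and> \<eta> \<in> dual s then t (pull f \<xi>) (pull g \<eta>) else 0)"
  by (simp add: tmap_def pull_def)

lemma pull_id [simp]: "pull id \<xi> = \<xi>" "pull (\<lambda>x. x) \<xi> = \<xi>"
  by (simp_all add: pull_def)

lemma pull_dual: "Vector_Spaces.linear s s f \<Longrightarrow> \<xi> \<in> dual s \<Longrightarrow> pull f \<xi> \<in> dual s"
  unfolding pull_def by (rule linear_comp_dual)

lemma pull_op:
  assumes "\<xi> \<in> dual s"
  shows "pull (f + g) \<xi> = pull f \<xi> + pull g \<xi>" "pull (f - g) \<xi> = pull f \<xi> - pull g \<xi>"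
  using assms by (auto simp: pull_def dual_add dual_diff fun_eq_iff)

lemma pull_lambda:
  assumes "\<xi> \<in> dual s"
  shows "pull (\<lambda>x. f x + g x) \<xi> = pull f \<xi> + pull g \<xi>" "pull (\<lambda>x. f x - g x) \<xi> = pull f \<xi> - pull g \<xi>"
  using pull_op[OF assms, of f g] by (simp_all add: plus_fun_def fun_diff_def)

lemma pull_add: "pull f (\<xi> + \<eta>) = pull f \<xi> + pull f \<eta>"
  for \<xi> :: "'w \<Rightarrow> 'k::plus"
  by (auto simp: pull_def fun_eq_iff)

lemma flip_apply: "flip t \<xi> \<eta> = t \<eta> \<xi>"
  by (simp add: flip_def)

section \<open>Quadratic perm algebras\<close>

context quadratic_perm_algebra
begin

lemmas circ_rules = bilinear_op_rules[OF circ_bilinear]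
lemmas form_rules = bilinear_op_rules[OF form_bilinear]

text \<open>\<open>form_invariant\<close> says that R has adjoint L - R. For a skew form, taking
  adjoints is an involution, so L - R has adjoint R; adding the two relations makes L
  self-adjoint.\<close>

lemma form_left: "\<omega> (x \<odot> y) z = \<omega> y (x \<odot> z)"
proof -
  have "\<omega> (x \<odot> y - y \<odot> x) z = - \<omega> z (x \<odot> y - y \<odot> x)" by (rule form_skew)
  also have "\<dots> = - \<omega> (z \<odot> x) y" by (simp add: form_invariant)
  also have "\<dots> = \<omega> y (z \<odot> x)" by (simp add: form_skew[of "z \<odot> x"])
  finally show ?thesis by (simp add: form_rules form_invariant[of y x z] algebra_simps)
qed

lemma form_right: "\<omega> (x \<odot> y) z = \<omega> x (y \<odot> z) - \<omega> x (z \<odot> y)"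
  by (simp add: form_invariant form_rules)

lemma form_word_commute: "\<omega> x (y \<odot> z \<odot> w) = \<omega> x (z \<odot> y \<odot> w)"
  by (simp add: circ_left_commute)

text \<open>Left multiplication by \<open>y \<odot> z\<close> is self-adjoint and the form is
  skew-symmetric.\<close>

lemma form_word_skew: "\<omega> x (y \<odot> z \<odot> w) = - \<omega> w (y \<odot> z \<odot> x)"
  using form_left[of "y \<odot> z" x w] form_skew[of "y \<odot> z \<odot> x" w] by simp

text \<open>With \<open>[x|w]\<close> for \<open>\<omega>(x, y z w)\<close>, where \<open>y\<close> and \<open>z\<close> are the other two of four fixed
  elements, this reads \<open>[x|w] = [x|y] + [y|w]\<close>: only three of the values are independent.\<close>

lemma form_word_cocycle: "\<omega> x (y \<odot> z \<odot> w) = \<omega> x (w \<odot> z \<odot> y) + \<omega> y (x \<odot> z \<odot> w)"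
proof -
  have "\<omega> x (y \<odot> (z \<odot> w)) = \<omega> (y \<odot> x) (z \<odot> w)"
    by (rule form_left[symmetric])
  also have "\<dots> = \<omega> y (x \<odot> (z \<odot> w)) - \<omega> y (z \<odot> w \<odot> x)"
    by (rule form_right)
  also have "\<omega> y (z \<odot> w \<odot> x) = - \<omega> x (z \<odot> w \<odot> y)"
    by (rule form_word_skew)
  also have "\<omega> x (z \<odot> w \<odot> y) = \<omega> x (w \<odot> z \<odot> y)"
    by (rule form_word_commute)
  finally show ?thesis unfolding circ_assoc by (simp only: diff_minus_eq_add add.commute)
qed

text \<open>A normal form for the scalars \<omega>(x, -) and \<omega>(y, -) on words in the other
  three elements: the right-hand sides involve only \<omega>(x, c d y), \<omega>(x, y d c) and
  \<omega>(x, y c d). The rules are meant for instantiation at four fixed elements.\<close>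

lemma form_words:
  shows "\<omega> x (d \<odot> c \<odot> y) = \<omega> x (c \<odot> d \<odot> y)"
    and "\<omega> x (d \<odot> y \<odot> c) = \<omega> x (y \<odot> d \<odot> c)"
    and "\<omega> x (c \<odot> y \<odot> d) = \<omega> x (y \<odot> c \<odot> d)"
    and "\<omega> y (c \<odot> d \<odot> x) = - \<omega> x (c \<odot> d \<odot> y)"
    and "\<omega> y (d \<odot> c \<odot> x) = - \<omega> x (c \<odot> d \<odot> y)"
    and "\<omega> y (x \<odot> d \<odot> c) = \<omega> x (y \<odot> d \<odot> c) - \<omega> x (c \<odot> d \<odot> y)"
    and "\<omega> y (d \<odot> x \<odot> c) = \<omega> x (y \<odot> d \<odot> c) - \<omega> x (c \<odot> d \<odot> y)"
    and "\<omega> y (x \<odot> c \<odot> d) = \<omega> x (y \<odot> c \<odot> d) - \<omega> x (c \<odot> d \<odot> y)"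
    and "\<omega> y (c \<odot> x \<odot> d) = \<omega> x (y \<odot> c \<odot> d) - \<omega> x (c \<odot> d \<odot> y)"
proof -
  have c: "\<omega> y (x \<odot> d \<odot> c) = \<omega> x (y \<odot> d \<odot> c) - \<omega> x (c \<odot> d \<odot> y)" for c d
    unfolding form_word_cocycle[of x y d c] by simp
  show "\<omega> y (c \<odot> d \<odot> x) = - \<omega> x (c \<odot> d \<odot> y)" by (rule form_word_skew)
  show "\<omega> y (d \<odot> c \<odot> x) = - \<omega> x (c \<odot> d \<odot> y)"
    by (simp only: form_word_commute[of y d c x] form_word_skew[of y c d x])
  show "\<omega> y (x \<odot> d \<odot> c) = \<omega> x (y \<odot> d \<odot> c) - \<omega> x (c \<odot> d \<odot> y)" by (rule c)
  show "\<omega> y (d \<odot> x \<odot> c) = \<omega> x (y \<odot> d \<odot> c) - \<omega> x (c \<odot> d \<odot> y)"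
    by (simp only: form_word_commute[of y d x c] c)
  show "\<omega> y (x \<odot> c \<odot> d) = \<omega> x (y \<odot> c \<odot> d) - \<omega> x (c \<odot> d \<odot> y)"
    by (simp only: c[of c d] form_word_commute[of x d c y])
  show "\<omega> y (c \<odot> x \<odot> d) = \<omega> x (y \<odot> c \<odot> d) - \<omega> x (c \<odot> d \<odot> y)"
    by (simp only: form_word_commute[of y c x d] c[of c d] form_word_commute[of x d c y])
qed (rule form_word_commute)+

section \<open>The form as an identification of the space with its dual\<close>

lemma form_dual [simp]: "(\<lambda>x. \<omega> x c) \<in> dual scale"
  by (rule bilinear_op_dual[OF form_bilinear])

lemma form_nondegenerate_left: "(\<And>x. \<omega> x y = \<omega> x z) \<Longrightarrow> y = z"
  using form_nondegenerate[of "y - z"] form_skew[of _ "y - z"] by (simp add: form_rules)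

lemma form_nondegenerate_right: "(\<And>x. \<omega> y x = \<omega> z x) \<Longrightarrow> y = z"
  using form_nondegenerate[of "y - z"] by (simp add: form_rules)

text \<open>Nondegeneracy makes the map from \<open>c\<close> to \<omega>(-, c) injective, and in
  finite dimension it is then surjective onto the dual.\<close>

lemma form_dual_surj:
  assumes "\<psi> \<in> dual scale"
  obtains c where "\<psi> = (\<lambda>x. \<omega> x c)"
proof -
  obtain E \<rho> where E: "finite E" "independent E" "span E = UNIV" and \<rho>: "\<And>e. \<rho> e \<in> dual scale"
    and rep: "\<And>x. (\<Sum>e\<in>E. scale (\<rho> e x) e) = x" by (rule coordinates) blast
  interpret E: finite_dimensional_vector_space scale E using E by unfold_locales auto
  \<comment> \<open>A functional is encoded by the vector whose coordinates are its values on the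
    basis. The map into the dual becomes an endomorphism of the space itself, to which the dimension
    argument applies.\<close>
  define \<Phi> where "\<Phi> c = (\<Sum>e\<in>E. scale (\<omega> e c) e)" for c
  have indep: "a e = b e" if "(\<Sum>e\<in>E. scale (a e) e) = (\<Sum>e\<in>E. scale (b e) e)" "e \<in> E" for a b e
  proof -
    have "(\<Sum>e\<in>E. scale (a e - b e) e) = 0"
      using that by (simp add: scale_left_diff_distrib sum_subtractf)
    then have "a e - b e = 0"
      using independentD[OF E(2) E(1) order_refl, of "\<lambda>e. a e - b e" e] that(2) by simp
    then show ?thesis by simp
  qed
  have lin: "Vector_Spaces.linear scale scale \<Phi>"
    unfolding Vector_Spaces.linear_iff \<Phi>_def using vector_space_axioms
    by (simp add: form_rules scale_left_distrib sum.distrib scale_sum_right)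
  have "inj \<Phi>"
  proof (rule injI)
    fix c d assume "\<Phi> c = \<Phi> d"
    then have *: "\<omega> e c = \<omega> e d" if "e \<in> E" for e
      unfolding \<Phi>_def using that by (rule indep)
    show "c = d"
    proof (rule form_nondegenerate_left)
      fix x
      have "\<omega> x c = (\<Sum>e\<in>E. \<rho> e x * \<omega> e c)" for c
        by (subst rep[of x, symmetric]) (simp add: dual_sum[OF form_dual] dual_scale[OF form_dual])
      then show "\<omega> x c = \<omega> x d" using * by simp
    qed
  qed
  then have "surj \<Phi>" by (rule E.linear_inj_imp_surj[OF lin])
  then obtain c where c: "(\<Sum>e\<in>E. scale (\<psi> e) e) = \<Phi> c" by (metis surjD)
  have *: "\<psi> e = \<omega> e c" if "e \<in> E" for e
    using c that unfolding \<Phi>_def by (rule indep)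
  have "\<psi> x = \<omega> x c" for x
  proof -
    have "\<xi> x = (\<Sum>e\<in>E. \<rho> e x * \<xi> e)" if "\<xi> \<in> dual scale" for \<xi>
      by (subst rep[of x, symmetric]) (simp add: dual_sum[OF that] dual_scale[OF that])
    then have "\<psi> x = (\<Sum>e\<in>E. \<rho> e x * \<psi> e)" "\<omega> x c = (\<Sum>e\<in>E. \<rho> e x * \<omega> e c)"
      using assms form_dual by blast+
    then show ?thesis using * by simp
  qed
  then show thesis using that by blast
qed

text \<open>The sum of the tensors of \<open>e\<close> and \<open>f e\<close> is the Casimir tensor
  of \<omega>. The two identities contract one leg each; since the form is skew-symmetric, one
  contraction is the identity and the other its negative.\<close>

lemma casimir:
  obtains E :: "'b set" and f :: "'b \<Rightarrow> 'b" where "finite E"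
    "\<And>d. (\<Sum>e\<in>E. scale (\<omega> (f e) d) e) = d" "\<And>c. (\<Sum>e\<in>E. scale (\<omega> e c) (f e)) = - c"
proof -
  obtain E \<rho> where E: "finite E" and \<rho>: "\<And>e. \<rho> e \<in> dual scale"
    and rep: "\<And>x. (\<Sum>e\<in>E. scale (\<rho> e x) e) = x" by (rule coordinates) blast
  have "\<exists>c. \<rho> e = (\<lambda>x. \<omega> x c)" for e by (rule form_dual_surj[OF \<rho>[of e]]) blast
  then obtain g where g: "\<And>e. \<rho> e = (\<lambda>x. \<omega> x (g e))" by metis
  \<comment> \<open>Here \<open>f e\<close> is \<open>- g e\<close>: by skew-symmetry, the
    coordinate \<open>\<omega> d (g e)\<close> of \<open>d\<close> equals
    \<open>\<omega> (- g e) d\<close>.\<close>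
  have 1: "(\<Sum>e\<in>E. scale (\<omega> (- g e) d) e) = d" for d
    using rep[of d] by (simp add: g form_rules form_skew[of d])
  \<comment> \<open>Paired with \<open>d\<close>, the left side is the same double sum as the first
    identity paired with \<open>c\<close>, so nondegeneracy gives the second identity from the
    first.\<close>
  have 2: "(\<Sum>e\<in>E. scale (\<omega> e c) (- g e)) = - c" for c
  proof (rule form_nondegenerate_right)
    fix d
    have "\<omega> (\<Sum>e\<in>E. scale (\<omega> e c) (- g e)) d = (\<Sum>e\<in>E. \<omega> e c * \<omega> (- g e) d)"
      by (simp only: dual_sum[OF form_dual] dual_scale[OF form_dual])
    also have "\<dots> = \<omega> (\<Sum>e\<in>E. scale (\<omega> (- g e) d) e) c"
      by (simp only: dual_sum[OF form_dual] dual_scale[OF form_dual] mult.commute)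
    also have "\<dots> = \<omega> (- c) d" unfolding 1 using form_skew[of d c] by (simp add: form_rules)
    finally show "\<omega> (\<Sum>e\<in>E. scale (\<omega> e c) (- g e)) d = \<omega> (- c) d" .
  qed
  show thesis by (rule that[OF E 1 2])
qed

lemma Tens2_form_eqI:
  assumes "t \<in> Tens2 scale" "u \<in> Tens2 scale"
    and "\<And>c d. t (\<lambda>x. \<omega> x c) (\<lambda>x. \<omega> x d) = u (\<lambda>x. \<omega> x c) (\<lambda>x. \<omega> x d)"
  shows "t = u"
proof (intro ext)
  fix \<xi> \<eta>
  show "t \<xi> \<eta> = u \<xi> \<eta>"
  proof (cases "\<xi> \<in> dual scale \<and> \<eta> \<in> dual scale")
    case True
    then obtain c d where "\<xi> = (\<lambda>x. \<omega> x c)" "\<eta> = (\<lambda>x. \<omega> x d)"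
      using form_dual_surj by meson
    then show ?thesis using assms(3) by simp
  qed (use assms(1,2) in \<open>simp add: Tens2_outside\<close>)
qed

text \<open>This resolves the definite description: an explicit tensor gives existence, and
  \<open>Tens2_form_eqI\<close> gives uniqueness because every functional is some \<omega>(-,
  c).\<close>

lemma nu_form:
  shows nu_form_Tens2: "nu_form scale circ \<omega> b \<in> Tens2 scale"
    and nu_form_apply: "nu_form scale circ \<omega> b (\<lambda>x. \<omega> x c) (\<lambda>x. \<omega> x d) = - \<omega> b (c \<odot> d)"
proof -
  obtain E f where E: "finite E" and f: "\<And>c. (\<Sum>e\<in>E. scale (\<omega> e c) (f e)) = - c"
    by (rule casimir) blast
  \<comment> \<open>Contracting the first leg with \<omega>(-, c) leaves
    \<open>- (c \<odot> b)\<close>, and self-adjointness of left multiplication turns its pairing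
    with \<open>d\<close> into \<open>- \<omega> b (c \<odot> d)\<close>.\<close>
  define t where "t = (\<Sum>e\<in>E. tens2 scale e (f e \<odot> b))"
  have t: "t (\<lambda>x. \<omega> x c) (\<lambda>x. \<omega> x d) = - \<omega> b (c \<odot> d)" for c d
  proof -
    have "t (\<lambda>x. \<omega> x c) (\<lambda>x. \<omega> x d) = \<omega> ((\<Sum>e\<in>E. scale (\<omega> e c) (f e)) \<odot> b) d"
      by (simp add: t_def sum_fun_apply bilinear_op_sum[OF circ_bilinear] circ_rules
          dual_sum[OF form_dual] dual_scale[OF form_dual])
    then show ?thesis by (simp add: f circ_rules form_rules form_left)
  qed
  have "t \<in> Tens2 scale \<and> (\<forall>c d. t (\<lambda>x. \<omega> x c) (\<lambda>x. \<omega> x d) = - \<omega> b (c \<odot> d))"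
    using t E by (auto simp: t_def intro: sum_in_Tens2)
  then have "\<exists>!t. t \<in> Tens2 scale \<and> (\<forall>c d. t (\<lambda>x. \<omega> x c) (\<lambda>x. \<omega> x d) = - \<omega> b (c \<odot> d))"
    by (intro ex1I[of _ t]) (auto intro!: Tens2_form_eqI)
  from theI'[OF this] show "nu_form scale circ \<omega> b \<in> Tens2 scale"
    "nu_form scale circ \<omega> b (\<lambda>x. \<omega> x c) (\<lambda>x. \<omega> x d) = - \<omega> b (c \<odot> d)"
    unfolding nu_form_def by auto
qed

end

section \<open>The induced structure and its dual\<close>

text \<open>The simplifier would use these pointwise rules to turn sums of functionals into abstractions,
  which the additivity rules below no longer match.\<close>

declare plus_fun_apply [simp del] zero_fun_apply [simp del] minus_apply [simp del] uminus_apply [simp del]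

lemmas fun_op_apply = plus_fun_apply zero_fun_apply minus_apply uminus_apply

text \<open>All hypotheses of the theorem except factorizability; the DPP bialgebra axioms follow
  from these alone.\<close>

locale induced_structure =
  P: poisson_bialgebra sP mul brk \<Delta> \<delta> +
  B: quadratic_perm_algebra sB circB \<omega> +
  tensor_product sP sB sA ten
  for sP :: "'k::field_char_0 \<Rightarrow> 'p::ab_group_add \<Rightarrow> 'p"
    and mul brk \<Delta> \<delta>
    and sB :: "'k \<Rightarrow> 'b::ab_group_add \<Rightarrow> 'b"
    and circB \<omega>
    and sA :: "'k \<Rightarrow> 'a::ab_group_add \<Rightarrow> 'a"
    and ten +
  fixes circ ast :: "'a \<Rightarrow> 'a \<Rightarrow> 'a"
    and \<nu> \<theta> :: "'a \<Rightarrow> ('a, 'k) ten2"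
  assumes circ_bilinear: "bilinear_op sA sA sA circ"
    and circ_ten: "circ (ten p b) (ten q b') = ten (mul p q) (circB b b')"
    and ast_bilinear: "bilinear_op sA sA sA ast"
    and ast_ten: "ast (ten p b) (ten q b') = ten (brk p q) (circB b b')"
    and nu_linear: "Vector_Spaces.linear sA scale2 \<nu>"
    and nu_ten: "\<nu> (ten p b) = bullet sP sB sA ten (\<Delta> p) (nu_form sB circB \<omega> b)"
    and theta_linear: "Vector_Spaces.linear sA scale2 \<theta>"
    and theta_ten: "\<theta> (ten p b) = bullet sP sB sA ten (\<delta> p) (nu_form sB circB \<omega> b)"
begin

section \<open>Pure tensors and the functionals that span the dual\<close>

lemmas ten_rules = bilinear_op_rules[OF bilinear]

text \<open>Scalars are absorbed by pure tensors, and the empty sum is the pure tensor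
  \<open>ten 0 0\<close>, so closure under addition covers the whole space.\<close>

lemma ten_induct:
  assumes "\<And>p b. Q (ten p b)" "\<And>x y. Q x \<Longrightarrow> Q y \<Longrightarrow> Q (x + y)"
  shows "Q x"
proof -
  obtain n v w where "x = (\<Sum>i<(n::nat). ten (v i) (w i))" using spanning[of x] by blast
  moreover have "Q (\<Sum>i<n. ten (v i) (w i))"
  proof (induction n)
    case 0
    show ?case using assms(1)[of 0 0] by (simp add: ten_rules)
  qed (use assms in auto)
  ultimately show ?thesis by simp
qed

lemma dual_eqI:
  assumes "\<xi> \<in> dual sA" "\<eta> \<in> dual sA" "\<And>p b. \<xi> (ten p b) = \<eta> (ten p b)"
  shows "\<xi> = \<eta>"
proof
  show "\<xi> x = \<eta> x" for x
    by (induction x rule: ten_induct) (simp_all add: assms(3) dual_add[OF assms(1)] dual_add[OF assms(2)])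
qed

text \<open>The functional written [f, c] at the outset. For linear \<open>f\<close> it exists by
  \<open>universal\<close>, and its values on pure tensors determine it.\<close>

definition fn :: "('p \<Rightarrow> 'k) \<Rightarrow> 'b \<Rightarrow> 'a \<Rightarrow> 'k" where
  "fn f c = (SOME F. F \<in> dual sA \<and> (\<forall>p b. F (ten p b) = f p * \<omega> b c))"

lemma fn:
  assumes "f \<in> dual sP"
  shows fn_dual: "fn f c \<in> dual sA" and fn_ten: "fn f c (ten p b) = f p * \<omega> b c"
proof -
  have "bilinear_op sP sB (*) (\<lambda>p b. f p * \<omega> b c)"
    by (rule vector_space.bilinear_opI[OF vector_space_field])
       (simp_all add: dual_add[OF assms] dual_scale[OF assms] B.form_rules algebra_simps
         P.vector_space_axioms B.vector_space_axioms)
  from universal[OF this] have "\<exists>F. F \<in> dual sA \<and> (\<forall>p b. F (ten p b) = f p * \<omega> b c)"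
    by (simp add: dual_def)
  then have "fn f c \<in> dual sA \<and> (\<forall>p b. fn f c (ten p b) = f p * \<omega> b c)"
    unfolding fn_def by (rule someI_ex)
  then show "fn f c \<in> dual sA" "fn f c (ten p b) = f p * \<omega> b c" by blast+
qed

lemma fn_eqI:
  assumes "\<xi> \<in> dual sA" "f \<in> dual sP" "\<And>p b. \<xi> (ten p b) = f p * \<omega> b c"
  shows "\<xi> = fn f c"
  using assms by (intro dual_eqI) (auto simp: fn)

lemma fn_rules:
  assumes "f \<in> dual sP"
  shows "fn f (c + d) = fn f c + fn f d" "fn f (c - d) = fn f c - fn f d" "fn f (- c) = - fn f c"
proof -
  show "fn f (c + d) = fn f c + fn f d"
    by (rule fn_eqI[symmetric])
       (simp_all add: assms fn B.form_rules plus_fun_apply distrib_left)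
  show "fn f (c - d) = fn f c - fn f d"
    by (rule fn_eqI[symmetric])
       (simp_all add: assms fn B.form_rules minus_apply right_diff_distrib)
  show "fn f (- c) = - fn f c"
    by (rule fn_eqI[symmetric]) (simp_all add: assms fn B.form_rules uminus_apply)
qed

text \<open>For a basis vector \<open>e\<close> of P the functional sending \<open>b\<close> to
  \<open>\<xi> (ten e b)\<close> is \<omega>(-, g e) for some \<open>g e\<close>. Hence \<xi> is the
  sum of the functionals \<open>fn (\<rho> e) (g e)\<close>, with \<rho> the coordinates on
  P.\<close>

lemma dual_induct [consumes 1]:
  assumes "\<xi> \<in> dual sA" "\<And>f c. f \<in> dual sP \<Longrightarrow> Q (fn f c)"
    and "\<And>\<xi> \<eta>. \<xi> \<in> dual sA \<Longrightarrow> \<eta> \<in> dual sA \<Longrightarrow> Q \<xi> \<Longrightarrow> Q \<eta> \<Longrightarrow> Q (\<xi> + \<eta>)"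
  shows "Q \<xi>"
proof -
  obtain E \<rho> where E: "finite E" and \<rho>: "\<And>e. \<rho> e \<in> dual sP"
    and rep: "\<And>x. (\<Sum>e\<in>E. sP (\<rho> e x) e) = x" by (rule P.coordinates) blast
  have "\<exists>c. \<forall>b. \<xi> (ten e b) = \<omega> b c" for e
  proof -
    have "(\<lambda>b. \<xi> (ten e b)) \<in> dual sB"
      by (rule B.dualI) (simp_all add: ten_rules dual_add[OF assms(1)] dual_scale[OF assms(1)])
    then obtain c where "(\<lambda>b. \<xi> (ten e b)) = (\<lambda>b. \<omega> b c)" by (rule B.form_dual_surj)
    then have "\<forall>b. \<xi> (ten e b) = \<omega> b c" by (simp add: fun_eq_iff)
    then show ?thesis ..
  qed
  then obtain g where g: "\<And>e b. \<xi> (ten e b) = \<omega> b (g e)" by metis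
  \<comment> \<open>Membership in the dual is carried along because the additive case demands it;
    the empty sum is the generator \<open>fn 0 0\<close>.\<close>
  have "(\<Sum>e\<in>F. fn (\<rho> e) (g e)) \<in> dual sA \<and> Q (\<Sum>e\<in>F. fn (\<rho> e) (g e))" if "finite F" for F
    using that
  proof induction
    case empty
    have "fn 0 0 = 0" by (rule fn_eqI[symmetric]) (auto simp: fun_op_apply)
    then show ?case using assms(2)[of 0 0] by simp
  next
    case (insert e F)
    then show ?case using assms(3)[of "fn (\<rho> e) (g e)"] by (simp add: fn \<rho> assms(2))
  qed
  note * = this[OF E]
  have "\<xi> = (\<Sum>e\<in>E. fn (\<rho> e) (g e))"
  proof (rule dual_eqI)
    fix p b
    have "\<xi> (ten p b) = \<xi> (ten (\<Sum>e\<in>E. sP (\<rho> e p) e) b)" by (simp only: rep)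
    also have "\<dots> = (\<Sum>e\<in>E. \<rho> e p * \<omega> b (g e))"
      by (simp add: bilinear_op_sum[OF bilinear] ten_rules dual_sum[OF assms(1)] dual_scale[OF assms(1)] g)
    finally show "\<xi> (ten p b) = (\<Sum>e\<in>E. fn (\<rho> e) (g e)) (ten p b)"
      by (simp add: sum_fun_apply fn \<rho>)
  qed (use assms(1) * in auto)
  then show ?thesis using * by simp
qed

text \<open>Additivity extends the agreement from generators to the dual, one argument at a time;
  elsewhere both tensors have the default value.\<close>

lemma Tens2_fn_eqI:
  assumes t: "t \<in> Tens2 sA" and u: "u \<in> Tens2 sA"
    and eq: "\<And>f c g d. f \<in> dual sP \<Longrightarrow> g \<in> dual sP \<Longrightarrow> t (fn f c) (fn g d) = u (fn f c) (fn g d)"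
  shows "t = u"
proof (intro ext)
  fix \<xi> \<eta>
  note bil = Tens2_bilinear[OF T.vector_space_axioms]
  show "t \<xi> \<eta> = u \<xi> \<eta>"
  proof (cases "\<xi> \<in> dual sA \<and> \<eta> \<in> dual sA")
    case True
    have *: "t (fn f c) \<eta> = u (fn f c) \<eta>" if "f \<in> dual sP" "\<eta> \<in> dual sA" for f c \<eta>
      using that(2) by (induction \<eta> rule: dual_induct) (simp_all add: eq that bil(2)[OF t] bil(2)[OF u] fn)
    from True have "\<xi> \<in> dual sA" by simp
    then show ?thesis
      by (induction \<xi> rule: dual_induct) (use True in \<open>simp_all add: * bil(1)[OF t] bil(1)[OF u] fn\<close>)
  qed (use t u in \<open>simp add: Tens2_outside\<close>)
qed

text \<open>The values of any candidate at generators are expressed by \<open>t\<close> and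
  \<open>u\<close> alone, without reference to the decompositions. As generators separate tensors,
  all candidates coincide and the definite description is proper.\<close>

lemma bullet:
  assumes t: "t \<in> Tens2 sP" and u: "u \<in> Tens2 sB"
  shows bullet_Tens2: "bullet sP sB sA ten t u \<in> Tens2 sA"
    and bullet_fn: "f \<in> dual sP \<Longrightarrow> g \<in> dual sP \<Longrightarrow>
      bullet sP sB sA ten t u (fn f c) (fn g d) = t f g * u (\<lambda>x. \<omega> x c) (\<lambda>x. \<omega> x d)"
proof -
  let ?D = "\<lambda>w. \<exists>(m::nat) (n::nat) p' p'' b' b''.
        t = (\<Sum>i<m. tens2 sP (p' i) (p'' i)) \<and> u = (\<Sum>j<n. tens2 sB (b' j) (b'' j)) \<and>
        w = (\<Sum>i<m. \<Sum>j<n. tens2 sA (ten (p' i) (b' j)) (ten (p'' i) (b'' j)))"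
  have D: "w \<in> Tens2 sA \<and> (\<forall>f c g d. f \<in> dual sP \<longrightarrow> g \<in> dual sP \<longrightarrow>
      w (fn f c) (fn g d) = t f g * u (\<lambda>x. \<omega> x c) (\<lambda>x. \<omega> x d))" if w: "?D w" for w
  proof -
    from w obtain m n :: nat and p' p'' b' b'' where tuw: "t = (\<Sum>i<m. tens2 sP (p' i) (p'' i))"
      "u = (\<Sum>j<n. tens2 sB (b' j) (b'' j))"
      "w = (\<Sum>i<m. \<Sum>j<n. tens2 sA (ten (p' i) (b' j)) (ten (p'' i) (b'' j)))" by blast
    \<comment> \<open>The double sum becomes a single sum over pairs, as \<open>sum_in_Tens2\<close>
      expects.\<close>
    have "w = (\<Sum>z\<in>{..<m} \<times> {..<n}. tens2 sA (ten (p' (fst z)) (b' (snd z))) (ten (p'' (fst z)) (b'' (snd z))))"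
      unfolding tuw by (simp add: sum.cartesian_product split_def)
    moreover have "w (fn f c) (fn g d) = t f g * u (\<lambda>x. \<omega> x c) (\<lambda>x. \<omega> x d)"
      if "f \<in> dual sP" "g \<in> dual sP" for f c g d
      using that by (simp add: tuw sum_fun_apply fn sum_product ac_simps)
    ultimately show ?thesis by (auto intro: sum_in_Tens2)
  qed
  obtain m p' p'' where t': "t = (\<Sum>i<(m::nat). tens2 sP (p' i) (p'' i))" using t by (rule Tens2E)
  obtain n b' b'' where u': "u = (\<Sum>i<(n::nat). tens2 sB (b' i) (b'' i))" using u by (rule Tens2E)
  have "\<exists>w. ?D w" using t' u' by blast
  then have "\<exists>!w. ?D w"
  proof (rule ex_ex1I)
    fix v w assume "?D v" "?D w"
    note D[OF this(1)] D[OF this(2)]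
    then show "v = w" by (intro Tens2_fn_eqI) auto
  qed
  note * = D[OF theI'[OF this]]
  then show "bullet sP sB sA ten t u \<in> Tens2 sA" unfolding bullet_def by blast
  show "bullet sP sB sA ten t u (fn f c) (fn g d) = t f g * u (\<lambda>x. \<omega> x c) (\<lambda>x. \<omega> x d)"
    if "f \<in> dual sP" "g \<in> dual sP"
    using * that unfolding bullet_def by blast
qed

section \<open>The induced coproducts on generators\<close>

lemma Delta_Tens2: "\<Delta> p \<in> Tens2 sP" and delta_Tens2: "\<delta> p \<in> Tens2 sP"
  using P.Delta_coproduct P.delta_coproduct by (auto simp: coproduct_def)

lemma nu_theta_add: "\<nu> (x + y) = \<nu> x + \<nu> y" "\<theta> (x + y) = \<theta> x + \<theta> y"
  using nu_linear theta_linear by (simp_all add: Vector_Spaces.linear_iff)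

lemma nu_Tens2: "\<nu> a \<in> Tens2 sA"
  by (induction a rule: ten_induct)
     (simp_all only: nu_ten nu_theta_add Tens2_add bullet_Tens2 Delta_Tens2 B.nu_form_Tens2)

lemma theta_Tens2: "\<theta> a \<in> Tens2 sA"
  by (induction a rule: ten_induct)
     (simp_all only: theta_ten nu_theta_add Tens2_add bullet_Tens2 delta_Tens2 B.nu_form_Tens2)

lemma nu_fn: "f \<in> dual sP \<Longrightarrow> g \<in> dual sP \<Longrightarrow>
    \<nu> (ten p b) (fn f c) (fn g d) = - (\<Delta> p f g * \<omega> b (circB c d))"
  by (simp add: nu_ten bullet_fn[OF Delta_Tens2 B.nu_form_Tens2] B.nu_form_apply)

lemma theta_fn: "f \<in> dual sP \<Longrightarrow> g \<in> dual sP \<Longrightarrow>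
    \<theta> (ten p b) (fn f c) (fn g d) = - (\<delta> p f g * \<omega> b (circB c d))"
  by (simp add: theta_ten bullet_fn[OF delta_Tens2 B.nu_form_Tens2] B.nu_form_apply)

lemma coproducts: "coproduct sA \<nu>" "coproduct sA \<theta>"
  using nu_Tens2 theta_Tens2 nu_linear theta_linear by (auto simp: coproduct_def)

text \<open>Pure tensors of basis vectors of P and B form a finite spanning set.\<close>

lemma A_fd_space: "fd_space sA"
proof -
  obtain E \<rho> where E: "finite E" and rep: "\<And>x. (\<Sum>e\<in>E. sP (\<rho> e x) e) = x"
    by (rule P.coordinates) blast
  obtain F \<sigma> where F: "finite F" and rep': "\<And>x. (\<Sum>e\<in>F. sB (\<sigma> e x) e) = x"
    by (rule B.coordinates) blast
  let ?S = "(\<lambda>(e, f). ten e f) ` (E \<times> F)"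
  have "x \<in> T.span ?S" for x
  proof (induction x rule: ten_induct)
    case (1 p b)
    have "ten p b = ten (\<Sum>e\<in>E. sP (\<rho> e p) e) (\<Sum>f\<in>F. sB (\<sigma> f b) f)" by (simp only: rep rep')
    also have "\<dots> = (\<Sum>f\<in>F. \<Sum>e\<in>E. sA (\<sigma> f b) (sA (\<rho> e p) (ten e f)))"
      by (simp add: bilinear_op_sum[OF bilinear] ten_rules T.scale_sum_right)
    also have "\<dots> \<in> T.span ?S" by (intro T.span_sum T.span_scale T.span_base) auto
    finally show ?case .
  qed (rule T.span_add)
  then show ?thesis using E F by (intro fd_spaceI[of sA ?S] T.vector_space_axioms) auto
qed

section \<open>Reduction of multilinear identities to pure tensors and generators\<close>

lemma tri_zero:
  assumes "\<And>x x' y z. Q (x + x') y z = Q x y z + Q x' y z"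
    and "\<And>x y y' z. Q x (y + y') z = Q x y z + Q x y' z"
    and "\<And>x y z z'. Q x y (z + z') = Q x y z + Q x y z'"
    and "\<And>p b q b' r b''. Q (ten p b) (ten q b') (ten r b'') = (0::'z::comm_monoid_add)"
  shows "Q x y z = 0"
proof -
  have "Q (ten p b) (ten q b') z = 0" for p b q b' z
    by (induction z rule: ten_induct) (auto simp: assms)
  then have "Q (ten p b) y z = 0" for p b y z
    by (induction y rule: ten_induct) (auto simp: assms)
  then show ?thesis
    by (induction x rule: ten_induct) (auto simp: assms)
qed

text \<open>An identity is treated as the vanishing of the difference of its sides, so that one
  additive function is enough.\<close>

lemma bi_zero:
  assumes "\<xi> \<in> dual sA" "\<eta> \<in> dual sA"
    and add: "\<And>\<xi> \<xi>' \<eta>. \<xi> \<in> dual sA \<Longrightarrow> \<xi>' \<in> dual sA \<Longrightarrow> \<eta> \<in> dual sA \<Longrightarrow> Q (\<xi> + \<xi>') \<eta> = Q \<xi> \<eta> + Q \<xi>' \<eta>"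
      "\<And>\<xi> \<eta> \<eta>'. \<xi> \<in> dual sA \<Longrightarrow> \<eta> \<in> dual sA \<Longrightarrow> \<eta>' \<in> dual sA \<Longrightarrow> Q \<xi> (\<eta> + \<eta>') = Q \<xi> \<eta> + Q \<xi> \<eta>'"
    and gen: "\<And>f c g d. f \<in> dual sP \<Longrightarrow> g \<in> dual sP \<Longrightarrow> Q (fn f c) (fn g d) = (0::'k)"
  shows "Q \<xi> \<eta> = 0"
proof -
  have *: "Q (fn f c) \<eta> = 0" if "\<eta> \<in> dual sA" "f \<in> dual sP" for f c \<eta>
    using that by (induction \<eta> rule: dual_induct) (auto simp: gen add fn)
  show ?thesis
    using assms(1,2) by (induction \<xi> rule: dual_induct) (auto simp: add fn *)
qed

lemma tri_fn_zero:
  assumes "\<xi> \<in> dual sA" "\<eta> \<in> dual sA" "\<zeta> \<in> dual sA"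
    and add: "\<And>\<xi> \<xi>' \<eta> \<zeta>. \<xi> \<in> dual sA \<Longrightarrow> \<xi>' \<in> dual sA \<Longrightarrow> \<eta> \<in> dual sA \<Longrightarrow> \<zeta> \<in> dual sA \<Longrightarrow>
        Q (\<xi> + \<xi>') \<eta> \<zeta> = Q \<xi> \<eta> \<zeta> + Q \<xi>' \<eta> \<zeta>"
      "\<And>\<xi> \<eta> \<eta>' \<zeta>. \<xi> \<in> dual sA \<Longrightarrow> \<eta> \<in> dual sA \<Longrightarrow> \<eta>' \<in> dual sA \<Longrightarrow> \<zeta> \<in> dual sA \<Longrightarrow>
        Q \<xi> (\<eta> + \<eta>') \<zeta> = Q \<xi> \<eta> \<zeta> + Q \<xi> \<eta>' \<zeta>"
      "\<And>\<xi> \<eta> \<zeta> \<zeta>'. \<xi> \<in> dual sA \<Longrightarrow> \<eta> \<in> dual sA \<Longrightarrow> \<zeta> \<in> dual sA \<Longrightarrow> \<zeta>' \<in> dual sA \<Longrightarrow>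
        Q \<xi> \<eta> (\<zeta> + \<zeta>') = Q \<xi> \<eta> \<zeta> + Q \<xi> \<eta> \<zeta>'"
    and gen: "\<And>f c g d h e. f \<in> dual sP \<Longrightarrow> g \<in> dual sP \<Longrightarrow> h \<in> dual sP \<Longrightarrow>
      Q (fn f c) (fn g d) (fn h e) = (0::'k)"
  shows "Q \<xi> \<eta> \<zeta> = 0"
proof -
  have *: "Q (fn f c) \<eta> \<zeta> = 0" if "\<eta> \<in> dual sA" "\<zeta> \<in> dual sA" "f \<in> dual sP" for f c \<eta> \<zeta>
    by (rule bi_zero[where Q = "Q (fn f c)"]) (simp_all add: that add fn gen)
  show ?thesis
    using assms(1-3) by (induction \<xi> rule: dual_induct) (auto simp: add fn *)
qed

lemma lin_eqI:
  fixes X Y :: "'a \<Rightarrow> ('a, 'k) ten2"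
  assumes outside: "\<And>a \<xi> \<eta>. \<not> (\<xi> \<in> dual sA \<and> \<eta> \<in> dual sA) \<Longrightarrow> X a \<xi> \<eta> = Y a \<xi> \<eta>"
    and add: "\<And>a a' \<xi> \<eta>. \<xi> \<in> dual sA \<Longrightarrow> \<eta> \<in> dual sA \<Longrightarrow> X (a + a') \<xi> \<eta> = X a \<xi> \<eta> + X a' \<xi> \<eta>"
      "\<And>a a' \<xi> \<eta>. \<xi> \<in> dual sA \<Longrightarrow> \<eta> \<in> dual sA \<Longrightarrow> Y (a + a') \<xi> \<eta> = Y a \<xi> \<eta> + Y a' \<xi> \<eta>"
      "\<And>a \<xi> \<xi>' \<eta>. \<xi> \<in> dual sA \<Longrightarrow> \<xi>' \<in> dual sA \<Longrightarrow> \<eta> \<in> dual sA \<Longrightarrow>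
        X a (\<xi> + \<xi>') \<eta> = X a \<xi> \<eta> + X a \<xi>' \<eta>"
      "\<And>a \<xi> \<xi>' \<eta>. \<xi> \<in> dual sA \<Longrightarrow> \<xi>' \<in> dual sA \<Longrightarrow> \<eta> \<in> dual sA \<Longrightarrow>
        Y a (\<xi> + \<xi>') \<eta> = Y a \<xi> \<eta> + Y a \<xi>' \<eta>"
      "\<And>a \<xi> \<eta> \<eta>'. \<xi> \<in> dual sA \<Longrightarrow> \<eta> \<in> dual sA \<Longrightarrow> \<eta>' \<in> dual sA \<Longrightarrow>
        X a \<xi> (\<eta> + \<eta>') = X a \<xi> \<eta> + X a \<xi> \<eta>'"
      "\<And>a \<xi> \<eta> \<eta>'. \<xi> \<in> dual sA \<Longrightarrow> \<eta> \<in> dual sA \<Longrightarrow> \<eta>' \<in> dual sA \<Longrightarrow>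
        Y a \<xi> (\<eta> + \<eta>') = Y a \<xi> \<eta> + Y a \<xi> \<eta>'"
    and gen: "\<And>p b f c g d. f \<in> dual sP \<Longrightarrow> g \<in> dual sP \<Longrightarrow>
      X (ten p b) (fn f c) (fn g d) = Y (ten p b) (fn f c) (fn g d)"
  shows "X = Y"
proof (intro ext)
  fix a \<xi> \<eta>
  show "X a \<xi> \<eta> = Y a \<xi> \<eta>"
  proof (cases "\<xi> \<in> dual sA \<and> \<eta> \<in> dual sA")
    case True
    have "X (ten p b) \<xi> \<eta> - Y (ten p b) \<xi> \<eta> = 0" for p b
      by (rule bi_zero[where Q = "\<lambda>\<xi> \<eta>. X (ten p b) \<xi> \<eta> - Y (ten p b) \<xi> \<eta>"])
        (simp_all add: True add gen add_diff_add)
    then show ?thesis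
      by (induction a rule: ten_induct) (simp_all add: True add)
  qed (rule outside)
qed

text \<open>The conclusion quantifies over \<open>a\<close> and \<open>b\<close> so that
  higher-order pattern unification finds \<open>X\<close> and \<open>Y\<close> when the rule is
  applied to a compatibility condition. The first premise treats default values, the last one pure
  tensors and generators, those between them additivity.\<close>

lemma quad_eqI:
  fixes X Y :: "'a \<Rightarrow> 'a \<Rightarrow> ('a, 'k) ten2"
  assumes outside: "\<And>a b \<xi> \<eta>. \<not> (\<xi> \<in> dual sA \<and> \<eta> \<in> dual sA) \<Longrightarrow> X a b \<xi> \<eta> = Y a b \<xi> \<eta>"
    and add: "\<And>a a' b \<xi> \<eta>. \<xi> \<in> dual sA \<Longrightarrow> \<eta> \<in> dual sA \<Longrightarrow> X (a + a') b \<xi> \<eta> = X a b \<xi> \<eta> + X a' b \<xi> \<eta>"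
      "\<And>a a' b \<xi> \<eta>. \<xi> \<in> dual sA \<Longrightarrow> \<eta> \<in> dual sA \<Longrightarrow> Y (a + a') b \<xi> \<eta> = Y a b \<xi> \<eta> + Y a' b \<xi> \<eta>"
      "\<And>a b b' \<xi> \<eta>. \<xi> \<in> dual sA \<Longrightarrow> \<eta> \<in> dual sA \<Longrightarrow> X a (b + b') \<xi> \<eta> = X a b \<xi> \<eta> + X a b' \<xi> \<eta>"
      "\<And>a b b' \<xi> \<eta>. \<xi> \<in> dual sA \<Longrightarrow> \<eta> \<in> dual sA \<Longrightarrow> Y a (b + b') \<xi> \<eta> = Y a b \<xi> \<eta> + Y a b' \<xi> \<eta>"
      "\<And>a b \<xi> \<xi>' \<eta>. \<xi> \<in> dual sA \<Longrightarrow> \<xi>' \<in> dual sA \<Longrightarrow> \<eta> \<in> dual sA \<Longrightarrow>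
        X a b (\<xi> + \<xi>') \<eta> = X a b \<xi> \<eta> + X a b \<xi>' \<eta>"
      "\<And>a b \<xi> \<xi>' \<eta>. \<xi> \<in> dual sA \<Longrightarrow> \<xi>' \<in> dual sA \<Longrightarrow> \<eta> \<in> dual sA \<Longrightarrow>
        Y a b (\<xi> + \<xi>') \<eta> = Y a b \<xi> \<eta> + Y a b \<xi>' \<eta>"
      "\<And>a b \<xi> \<eta> \<eta>'. \<xi> \<in> dual sA \<Longrightarrow> \<eta> \<in> dual sA \<Longrightarrow> \<eta>' \<in> dual sA \<Longrightarrow>
        X a b \<xi> (\<eta> + \<eta>') = X a b \<xi> \<eta> + X a b \<xi> \<eta>'"
      "\<And>a b \<xi> \<eta> \<eta>'. \<xi> \<in> dual sA \<Longrightarrow> \<eta> \<in> dual sA \<Longrightarrow> \<eta>' \<in> dual sA \<Longrightarrow>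
        Y a b \<xi> (\<eta> + \<eta>') = Y a b \<xi> \<eta> + Y a b \<xi> \<eta>'"
    and gen: "\<And>p b q b' f c g d. f \<in> dual sP \<Longrightarrow> g \<in> dual sP \<Longrightarrow>
      X (ten p b) (ten q b') (fn f c) (fn g d) = Y (ten p b) (ten q b') (fn f c) (fn g d)"
  shows "\<forall>a b. X a b = Y a b"
proof (intro allI ext)
  fix a b \<xi> \<eta>
  show "X a b \<xi> \<eta> = Y a b \<xi> \<eta>"
  proof (cases "\<xi> \<in> dual sA \<and> \<eta> \<in> dual sA")
    case True
    have *: "X (ten p b) (ten q b') \<xi> \<eta> - Y (ten p b) (ten q b') \<xi> \<eta> = 0" for p b q b'
      by (rule bi_zero[where Q = "\<lambda>\<xi> \<eta>. X (ten p b) (ten q b') \<xi> \<eta> - Y (ten p b) (ten q b') \<xi> \<eta>"]) (simp_all add: True add gen add_diff_add)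
    have "X (ten p b) b' \<xi> \<eta> = Y (ten p b) b' \<xi> \<eta>" for p b b'
      by (induction b' rule: ten_induct) (simp_all add: True add *[simplified])
    then show ?thesis
      by (induction a rule: ten_induct) (simp_all add: True add)
  qed (rule outside)
qed

lemma tri_eqI:
  fixes X Y :: "'a \<Rightarrow> ('a, 'k) ten3"
  assumes outside: "\<And>a \<xi> \<eta> \<zeta>. \<not> (\<xi> \<in> dual sA \<and> \<eta> \<in> dual sA \<and> \<zeta> \<in> dual sA) \<Longrightarrow> X a \<xi> \<eta> \<zeta> = Y a \<xi> \<eta> \<zeta>"
    and add: "\<And>a a' \<xi> \<eta> \<zeta>. \<xi> \<in> dual sA \<Longrightarrow> \<eta> \<in> dual sA \<Longrightarrow> \<zeta> \<in> dual sA \<Longrightarrow>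
        X (a + a') \<xi> \<eta> \<zeta> = X a \<xi> \<eta> \<zeta> + X a' \<xi> \<eta> \<zeta>"
      "\<And>a a' \<xi> \<eta> \<zeta>. \<xi> \<in> dual sA \<Longrightarrow> \<eta> \<in> dual sA \<Longrightarrow> \<zeta> \<in> dual sA \<Longrightarrow>
        Y (a + a') \<xi> \<eta> \<zeta> = Y a \<xi> \<eta> \<zeta> + Y a' \<xi> \<eta> \<zeta>"
      "\<And>a \<xi> \<xi>' \<eta> \<zeta>. \<xi> \<in> dual sA \<Longrightarrow> \<xi>' \<in> dual sA \<Longrightarrow> \<eta> \<in> dual sA \<Longrightarrow> \<zeta> \<in> dual sA \<Longrightarrow>
        X a (\<xi> + \<xi>') \<eta> \<zeta> = X a \<xi> \<eta> \<zeta> + X a \<xi>' \<eta> \<zeta>"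
      "\<And>a \<xi> \<xi>' \<eta> \<zeta>. \<xi> \<in> dual sA \<Longrightarrow> \<xi>' \<in> dual sA \<Longrightarrow> \<eta> \<in> dual sA \<Longrightarrow> \<zeta> \<in> dual sA \<Longrightarrow>
        Y a (\<xi> + \<xi>') \<eta> \<zeta> = Y a \<xi> \<eta> \<zeta> + Y a \<xi>' \<eta> \<zeta>"
      "\<And>a \<xi> \<eta> \<eta>' \<zeta>. \<xi> \<in> dual sA \<Longrightarrow> \<eta> \<in> dual sA \<Longrightarrow> \<eta>' \<in> dual sA \<Longrightarrow> \<zeta> \<in> dual sA \<Longrightarrow>
        X a \<xi> (\<eta> + \<eta>') \<zeta> = X a \<xi> \<eta> \<zeta> + X a \<xi> \<eta>' \<zeta>"
      "\<And>a \<xi> \<eta> \<eta>' \<zeta>. \<xi> \<in> dual sA \<Longrightarrow> \<eta> \<in> dual sA \<Longrightarrow> \<eta>' \<in> dual sA \<Longrightarrow> \<zeta> \<in> dual sA \<Longrightarrow>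
        Y a \<xi> (\<eta> + \<eta>') \<zeta> = Y a \<xi> \<eta> \<zeta> + Y a \<xi> \<eta>' \<zeta>"
      "\<And>a \<xi> \<eta> \<zeta> \<zeta>'. \<xi> \<in> dual sA \<Longrightarrow> \<eta> \<in> dual sA \<Longrightarrow> \<zeta> \<in> dual sA \<Longrightarrow> \<zeta>' \<in> dual sA \<Longrightarrow>
        X a \<xi> \<eta> (\<zeta> + \<zeta>') = X a \<xi> \<eta> \<zeta> + X a \<xi> \<eta> \<zeta>'"
      "\<And>a \<xi> \<eta> \<zeta> \<zeta>'. \<xi> \<in> dual sA \<Longrightarrow> \<eta> \<in> dual sA \<Longrightarrow> \<zeta> \<in> dual sA \<Longrightarrow> \<zeta>' \<in> dual sA \<Longrightarrow>
        Y a \<xi> \<eta> (\<zeta> + \<zeta>') = Y a \<xi> \<eta> \<zeta> + Y a \<xi> \<eta> \<zeta>'"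
    and gen: "\<And>p b f c g d h e. f \<in> dual sP \<Longrightarrow> g \<in> dual sP \<Longrightarrow> h \<in> dual sP \<Longrightarrow>
      X (ten p b) (fn f c) (fn g d) (fn h e) = Y (ten p b) (fn f c) (fn g d) (fn h e)"
  shows "X a = Y a"
proof (intro ext)
  fix \<xi> \<eta> \<zeta>
  show "X a \<xi> \<eta> \<zeta> = Y a \<xi> \<eta> \<zeta>"
  proof (cases "\<xi> \<in> dual sA \<and> \<eta> \<in> dual sA \<and> \<zeta> \<in> dual sA")
    case True
    have "X (ten p b) \<xi> \<eta> \<zeta> - Y (ten p b) \<xi> \<eta> \<zeta> = 0" for p b
      by (rule tri_fn_zero[where Q = "\<lambda>\<xi> \<eta> \<zeta>. X (ten p b) \<xi> \<eta> \<zeta> - Y (ten p b) \<xi> \<eta> \<zeta>"]) (simp_all add: True add gen add_diff_add)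
    then show ?thesis
      by (induction a rule: ten_induct) (simp_all add: True add)
  qed (rule outside)
qed

end

text \<open>Typed instances of the pointwise rules: they unfold sums of tensors and of maps on
  tensors while sums of functionals stay intact.\<close>

lemma ten2_op_apply:
  fixes t u :: "('v, 'k::field) ten2" and F G :: "('v, 'k) ten2 \<Rightarrow> ('v, 'k) ten2"
  shows "(t + u) \<xi> \<eta> = t \<xi> \<eta> + u \<xi> \<eta>" "(t - u) \<xi> \<eta> = t \<xi> \<eta> - u \<xi> \<eta>" "(- t) \<xi> \<eta> = - t \<xi> \<eta>"
    and "(F + G) t = F t + G t" "(F - G) t = F t - G t" "(- F) t = - F t"
  by (simp_all add: fun_op_apply)

lemma ten3_op_apply:
  fixes t u :: "('v, 'k::field) ten3"
  shows "(t + u) \<xi> \<eta> \<zeta> = t \<xi> \<eta> \<zeta> + u \<xi> \<eta> \<zeta>" "(t - u) \<xi> \<eta> \<zeta> = t \<xi> \<eta> \<zeta> - u \<xi> \<eta> \<zeta>"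
    "(- t) \<xi> \<eta> \<zeta> = - t \<xi> \<eta> \<zeta>"
  by (simp_all add: fun_op_apply)

text \<open>The product on the dual space that is transpose to the coproduct \<open>D\<close>.\<close>

definition dpair :: "('v \<Rightarrow> ('v, 'k) ten2) \<Rightarrow> ('v \<Rightarrow> 'k) \<Rightarrow> ('v \<Rightarrow> 'k) \<Rightarrow> 'v \<Rightarrow> 'k" where
  "dpair D \<xi> \<eta> = (\<lambda>x. D x \<xi> \<eta>)"

lemma cop_apply:
  "cop_id D t \<xi> \<eta> \<zeta> = t (dpair D \<xi> \<eta>) \<zeta>" "id_cop D t \<xi> \<eta> \<zeta> = t \<xi> (dpair D \<eta> \<zeta>)"
  "flip12 v \<xi> \<eta> \<zeta> = v \<eta> \<xi> \<zeta>"
  by (simp_all add: cop_id_def id_cop_def flip12_def dpair_def)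

lemma dpair_dual: "coproduct s D \<Longrightarrow> dpair D \<xi> \<eta> \<in> dual s"
  unfolding dpair_def by (rule coproduct_dual)

section \<open>Transposed multiplications and dual products on generators\<close>

context induced_structure
begin

lemmas A_linear = bilinear_op_linear[OF circ_bilinear] bilinear_op_linear[OF ast_bilinear]

lemma brk_skew: "brk y x = - brk x y"
proof -
  have "brk (x + y) (x + y) = 0" by (rule P.brk_alternating)
  then have "brk x y + brk y x = 0"
    unfolding bilinear_op_simps[OF P.brk_bilinear] by (simp add: P.brk_alternating add.commute)
  then show ?thesis by (simp add: eq_neg_iff_add_eq_0 add.commute)
qed

lemma pull_dual_simps:
  "\<xi> \<in> dual sA \<Longrightarrow> pull (circ a) \<xi> \<in> dual sA" "\<xi> \<in> dual sA \<Longrightarrow> pull (\<lambda>x. circ x a) \<xi> \<in> dual sA"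
  "\<xi> \<in> dual sA \<Longrightarrow> pull (ast a) \<xi> \<in> dual sA" "\<xi> \<in> dual sA \<Longrightarrow> pull (\<lambda>x. ast x a) \<xi> \<in> dual sA"
  "f \<in> dual sP \<Longrightarrow> pull (mul p) f \<in> dual sP" "f \<in> dual sP \<Longrightarrow> pull (brk p) f \<in> dual sP"
  by (simp_all add: pull_dual A_linear bilinear_op_linear[OF P.mul_bilinear] bilinear_op_linear[OF P.brk_bilinear])

lemma pull_add_arg:
  assumes "\<xi> \<in> dual sA"
  shows "pull (circ (a + b)) \<xi> = pull (circ a) \<xi> + pull (circ b) \<xi>"
    "pull (\<lambda>x. circ x (a + b)) \<xi> = pull (\<lambda>x. circ x a) \<xi> + pull (\<lambda>x. circ x b) \<xi>"
    "pull (ast (a + b)) \<xi> = pull (ast a) \<xi> + pull (ast b) \<xi>"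
    "pull (\<lambda>x. ast x (a + b)) \<xi> = pull (\<lambda>x. ast x a) \<xi> + pull (\<lambda>x. ast x b) \<xi>"
  by (simp_all add: pull_def fun_eq_iff fun_op_apply dual_add[OF assms]
      bilinear_op_rules[OF circ_bilinear] bilinear_op_rules[OF ast_bilinear])

text \<open>A transposed multiplication acts on \<open>f\<close> by the Poisson transpose and on
  \<open>c\<close> by the adjoint with respect to \<omega>: L for L, and L - R for R. Skew-symmetry
  of the bracket reverses the sign in the last case.\<close>

lemma pull_fn:
  assumes "f \<in> dual sP"
  shows "pull (circ (ten p b)) (fn f c) = fn (pull (mul p) f) (circB b c)"
    "pull (\<lambda>x. circ x (ten p b)) (fn f c) = fn (pull (mul p) f) (circB b c - circB c b)"
    "pull (ast (ten p b)) (fn f c) = fn (pull (brk p) f) (circB b c)"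
    "pull (\<lambda>x. ast x (ten p b)) (fn f c) = fn (pull (brk p) f) (circB c b - circB b c)"
proof -
  show "pull (circ (ten p b)) (fn f c) = fn (pull (mul p) f) (circB b c)"
    by (rule fn_eqI) (simp_all add: assms fn pull_dual_simps, simp add: pull_def circ_ten fn assms B.form_left)
  show "pull (\<lambda>x. circ x (ten p b)) (fn f c) = fn (pull (mul p) f) (circB b c - circB c b)"
    by (rule fn_eqI) (simp_all add: assms fn pull_dual_simps,
        simp add: pull_def circ_ten fn assms B.form_invariant P.mul_commute[of _ p])
  show "pull (ast (ten p b)) (fn f c) = fn (pull (brk p) f) (circB b c)"
    by (rule fn_eqI) (simp_all add: assms fn pull_dual_simps, simp add: pull_def ast_ten fn assms B.form_left)
  show "pull (\<lambda>x. ast x (ten p b)) (fn f c) = fn (pull (brk p) f) (circB c b - circB b c)"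
    by (rule fn_eqI) (simp_all add: assms fn pull_dual_simps,
        simp add: pull_def ast_ten fn assms B.form_invariant brk_skew[of p] dual_minus[OF assms] B.form_rules algebra_simps)
qed

lemmas nu_bil = Tens2_bilinear[OF T.vector_space_axioms nu_Tens2]
  Tens2_homogeneous(1,2)[OF T.vector_space_axioms nu_Tens2]
lemmas theta_bil = Tens2_bilinear[OF T.vector_space_axioms theta_Tens2]
  Tens2_homogeneous(1,2)[OF T.vector_space_axioms theta_Tens2]
lemmas Delta_bil = Tens2_bilinear[OF P.vector_space_axioms Delta_Tens2]
  Tens2_homogeneous(1,2)[OF P.vector_space_axioms Delta_Tens2]
lemmas delta_bil = Tens2_bilinear[OF P.vector_space_axioms delta_Tens2]
  Tens2_homogeneous(1,2)[OF P.vector_space_axioms delta_Tens2]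

lemma dpair_dual_simps:
  "dpair \<nu> \<xi> \<eta> \<in> dual sA" "dpair \<theta> \<xi> \<eta> \<in> dual sA" "dpair \<Delta> f g \<in> dual sP" "dpair \<delta> f g \<in> dual sP"
  by (rule dpair_dual, rule coproducts P.Delta_coproduct P.delta_coproduct)+

lemma dpair_add:
  assumes "\<xi> \<in> dual sA" "\<eta> \<in> dual sA" "\<zeta> \<in> dual sA"
  shows "dpair \<nu> (\<xi> + \<eta>) \<zeta> = dpair \<nu> \<xi> \<zeta> + dpair \<nu> \<eta> \<zeta>" "dpair \<nu> \<zeta> (\<xi> + \<eta>) = dpair \<nu> \<zeta> \<xi> + dpair \<nu> \<zeta> \<eta>"
    "dpair \<theta> (\<xi> + \<eta>) \<zeta> = dpair \<theta> \<xi> \<zeta> + dpair \<theta> \<eta> \<zeta>" "dpair \<theta> \<zeta> (\<xi> + \<eta>) = dpair \<theta> \<zeta> \<xi> + dpair \<theta> \<zeta> \<eta>"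
  using assms by (simp_all add: dpair_def fun_eq_iff plus_fun_apply nu_bil theta_bil)

text \<open>The dual product is, up to sign, again a tensor product: the product dual to the Poisson
  coproduct in one factor and that of B in the other. The sign occurs twice in an iterated coproduct
  and cancels.\<close>

lemma dpair_fn:
  assumes "f \<in> dual sP" "g \<in> dual sP"
  shows "dpair \<nu> (fn f c) (fn g d) = - fn (dpair \<Delta> f g) (circB c d)"
    "dpair \<theta> (fn f c) (fn g d) = - fn (dpair \<delta> f g) (circB c d)"
  by (rule dual_eqI; simp add: dpair_dual_simps fn assms fun_op_apply;
      simp add: dpair_def nu_fn theta_fn assms)+

lemma dpair_outside:
  assumes "\<not> (\<xi> \<in> dual sA \<and> \<eta> \<in> dual sA)"
  shows "dpair \<nu> \<xi> \<eta> = 0" "dpair \<theta> \<xi> \<eta> = 0"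
  using Tens2_outside[OF nu_Tens2 assms] Tens2_outside[OF theta_Tens2 assms]
  by (simp_all add: dpair_def fun_eq_iff fun_op_apply)

text \<open>With \<open>dpair_outside\<close> this settles the coalgebra axioms at nonlinear
  arguments: the inner coproduct gives the zero functional, on which the outer one vanishes.\<close>

lemma zero_arg:
  "\<nu> a 0 \<zeta> = 0" "\<nu> a \<zeta> 0 = 0" "\<theta> a 0 \<zeta> = 0" "\<theta> a \<zeta> 0 = 0"
proof -
  have *: "t 0 \<zeta> = 0 \<and> t \<zeta> 0 = 0" if "t \<in> Tens2 sA" for t \<zeta>
    using Tens2_outside[OF that] Tens2_bilinear(3,4)[OF T.vector_space_axioms that, of 0 0 \<zeta>]
    by (cases "\<zeta> \<in> dual sA") auto
  show "\<nu> a 0 \<zeta> = 0" "\<nu> a \<zeta> 0 = 0" "\<theta> a 0 \<zeta> = 0" "\<theta> a \<zeta> 0 = 0"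
    using *[OF nu_Tens2] *[OF theta_Tens2] by auto
qed


section \<open>The axioms of a DPP bialgebra\<close>

lemmas mul_rules = bilinear_op_rules[OF P.mul_bilinear]
lemmas brk_rules = bilinear_op_rules[OF P.brk_bilinear]
lemmas circA_rules = bilinear_op_rules[OF circ_bilinear]
lemmas astA_rules = bilinear_op_rules[OF ast_bilinear]

lemma brk_mul_left: "brk (mul p q) r = mul p (brk q r) + mul q (brk p r)"
proof -
  have "brk (mul p q) r = - brk r (mul p q)" by (rule brk_skew)
  also have "\<dots> = mul p (brk q r) + mul q (brk p r)"
    by (simp add: P.brk_derivation brk_skew[of q r] brk_skew[of p r] mul_rules P.mul_commute[of "brk r p" q])
  finally show ?thesis .
qed

lemma brk_leibniz: "brk p (brk q r) = brk (brk p q) r + brk q (brk p r)"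
proof -
  have "brk p (brk q r) = - (brk q (brk r p) + brk r (brk p q))"
    using P.brk_jacobi[of p q r] by (simp only: eq_neg_iff_add_eq_0 add.assoc)
  also have "\<dots> = brk (brk p q) r + brk q (brk p r)"
    by (simp add: brk_skew[of r p] brk_skew[of r "brk p q"] brk_rules)
  finally show ?thesis .
qed

text \<open>On pure tensors the words in B agree up to exchanging their first two letters, which a
  perm algebra permits. What remains is an identity of Poisson algebras in the first factor.\<close>

lemma dpp_algebra: "dpp_algebra sA circ ast"
proof -
  interpret A: fd_space sA by (rule A_fd_space)
  note gen = circ_ten ast_ten B.circ_assoc
  note bil = circA_rules astA_rules
  show ?thesis
  proof unfold_locales
    fix x y z
    have "circ x (circ y z) - circ (circ x y) z = 0"
      by (rule tri_zero[where Q = "\<lambda>x y z. circ x (circ y z) - circ (circ x y) z"])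
         (simp_all add: bil gen P.mul_assoc)
    then show "circ x (circ y z) = circ (circ x y) z" by simp
    have "circ (circ x y) z - circ (circ y x) z = 0"
    proof (rule tri_zero[where Q = "\<lambda>x y z. circ (circ x y) z - circ (circ y x) z"])
      fix p b q b' r b''
      show "circ (circ (ten p b) (ten q b')) (ten r b'') - circ (circ (ten q b') (ten p b)) (ten r b'') = 0"
        by (simp add: gen B.circ_left_commute[of b b'] P.mul_commute[of p q])
    qed (simp_all add: bil)
    then show "circ (circ x y) z = circ (circ y x) z" by simp
    have "ast x (ast y z) - (ast (ast x y) z + ast y (ast x z)) = 0"
    proof (rule tri_zero[where Q = "\<lambda>x y z. ast x (ast y z) - (ast (ast x y) z + ast y (ast x z))"])
      fix p b q b' r b''
      show "ast (ten p b) (ast (ten q b') (ten r b'')) - (ast (ast (ten p b) (ten q b')) (ten r b'') +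
          ast (ten q b') (ast (ten p b) (ten r b''))) = 0"
        by (simp add: gen B.circ_left_commute[of b b'] brk_leibniz[of p q] ten_rules)
    qed (simp_all add: bil)
    then show "ast x (ast y z) = ast (ast x y) z + ast y (ast x z)" by simp
    have "ast (circ x y) z - (circ x (ast y z) + circ y (ast x z)) = 0"
    proof (rule tri_zero[where Q = "\<lambda>x y z. ast (circ x y) z - (circ x (ast y z) + circ y (ast x z))"])
      fix p b q b' r b''
      show "ast (circ (ten p b) (ten q b')) (ten r b'') - (circ (ten p b) (ast (ten q b') (ten r b'')) +
          circ (ten q b') (ast (ten p b) (ten r b''))) = 0"
        by (simp add: gen B.circ_left_commute[of b b'] brk_mul_left ten_rules)
    qed (simp_all add: bil)
    then show "ast (circ x y) z = circ x (ast y z) + circ y (ast x z)" by simp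
    have "circ (ast x y) z - (ast x (circ y z) - circ y (ast x z)) = 0"
    proof (rule tri_zero[where Q = "\<lambda>x y z. circ (ast x y) z - (ast x (circ y z) - circ y (ast x z))"])
      fix p b q b' r b''
      show "circ (ast (ten p b) (ten q b')) (ten r b'') - (ast (ten p b) (circ (ten q b') (ten r b'')) -
          circ (ten q b') (ast (ten p b) (ten r b''))) = 0"
        by (simp add: gen B.circ_left_commute[of b b'] P.brk_derivation ten_rules)
    qed (simp_all add: bil)
    then show "circ (ast x y) z = ast x (circ y z) - circ y (ast x z)" by simp
    have "circ (ast x y) z + circ (ast y x) z = 0"
    proof (rule tri_zero[where Q = "\<lambda>x y z. circ (ast x y) z + circ (ast y x) z"])
      fix p b q b' r b''
      show "circ (ast (ten p b) (ten q b')) (ten r b'') + circ (ast (ten q b') (ten p b)) (ten r b'') = 0"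
        by (simp add: gen B.circ_left_commute[of b b'] brk_skew[of p q] mul_rules ten_rules bil)
    qed (simp_all add: bil)
    then show "circ (ast x y) z = - circ (ast y x) z" by (simp add: eq_neg_iff_add_eq_0)
  qed (rule circ_bilinear ast_bilinear)+
qed

section \<open>The coalgebra axioms\<close>

lemma P_coalgebra:
  shows "\<Delta> p g f = \<Delta> p f g" "\<delta> p g f = - \<delta> p f g"
    and "\<Delta> p (dpair \<Delta> f g) h = \<Delta> p f (dpair \<Delta> g h)"
    and "\<delta> p (dpair \<delta> f g) h = \<delta> p f (dpair \<delta> g h) - \<delta> p g (dpair \<delta> f h)"
    and "\<delta> p f (dpair \<Delta> g h) = \<Delta> p (dpair \<delta> f g) h + \<Delta> p g (dpair \<delta> f h)"
proof -
  show "\<Delta> p g f = \<Delta> p f g" using P.Delta_cocommutative[of p] by (metis flip_apply)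
  show "\<delta> p g f = - \<delta> p f g"
    using fun_cong[OF fun_cong[OF P.delta_skew[of p]], of f g] by (simp add: flip_apply ten2_op_apply)
  note a = fun_cong[OF fun_cong[OF fun_cong], of _ _ f g h]
  show "\<Delta> p (dpair \<Delta> f g) h = \<Delta> p f (dpair \<Delta> g h)"
    using a[OF P.Delta_coassociative[of p]] by (simp add: cop_apply)
  show "\<delta> p (dpair \<delta> f g) h = \<delta> p f (dpair \<delta> g h) - \<delta> p g (dpair \<delta> f h)"
    using a[OF P.delta_cojacobi[of p]] by (simp add: cop_apply ten3_op_apply)
  show "\<delta> p f (dpair \<Delta> g h) = \<Delta> p (dpair \<delta> f g) h + \<Delta> p g (dpair \<delta> f h)"
    using a[OF P.coderivation[of p]] by (simp add: cop_apply ten3_op_apply)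
qed

lemma dpair_Delta_commute: "dpair \<Delta> g f = dpair \<Delta> f g"
  unfolding dpair_def fun_eq_iff by (intro allI) (rule P_coalgebra)

lemma dpair_delta_skew: "dpair \<delta> g f = - dpair \<delta> f g"
  unfolding dpair_def fun_eq_iff uminus_apply by (intro allI) (rule P_coalgebra)

lemmas co_rules = cop_apply ten3_op_apply ten2_op_apply dpair_fn dpair_add dpair_dual_simps
  nu_bil theta_bil Delta_bil delta_bil nu_theta_add nu_fn theta_fn fn

lemmas co_outside = dpair_outside zero_arg Tens2_outside[OF nu_Tens2] Tens2_outside[OF theta_Tens2]

text \<open>Dual to the algebra case: at generators both sides carry the scalar \<omega>(b, c d e),
  where \<open>c\<close> and \<open>d\<close> may be exchanged, and the other factor is an identity
  of Poisson coalgebras.\<close>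

lemma dpp_coalgebra: "dpp_coalgebra sA \<nu> \<theta>"
proof -
  interpret A: fd_space sA by (rule A_fd_space)
  show ?thesis
  proof unfold_locales
    show "coproduct sA \<nu>" "coproduct sA \<theta>" by (rule coproducts)+
    fix a
    show "cop_id \<nu> (\<nu> a) = id_cop \<nu> (\<nu> a)"
    proof (rule tri_eqI, goal_cases)
      \<comment> \<open>The tenth premise of \<open>tri_eqI\<close> is the evaluation at generators;
        the other nine concern default values and additivity.\<close>
      case (10 p b f c g d h e)
      then show ?case by (simp add: co_rules P_coalgebra(3) B.circ_assoc)
    qed (auto simp: co_rules co_outside)
    show "id_cop \<nu> (\<nu> a) = flip12 (id_cop \<nu> (\<nu> a))"
    proof (rule tri_eqI, goal_cases)
      case (10 p b f c g d h e)
      \<comment> \<open>By coassociativity both sides equal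
        \<open>\<Delta> p (dpair \<Delta> f g) h\<close>, whose inner product is
        commutative.\<close>
      have "\<Delta> p g (dpair \<Delta> f h) = \<Delta> p f (dpair \<Delta> g h)"
        using P_coalgebra(3)[of p g f h] P_coalgebra(3)[of p f g h]
        by (simp only: dpair_Delta_commute[of g f])
      with 10 show ?case by (simp add: co_rules B.circ_assoc B.circ_left_commute[of d c])
    qed (auto simp: co_rules co_outside)
    show "id_cop \<theta> (\<theta> a) = cop_id \<theta> (\<theta> a) + flip12 (id_cop \<theta> (\<theta> a))"
    proof (rule tri_eqI, goal_cases)
      case (10 p b f c g d h e)
      then show ?case
        by (simp add: co_rules P_coalgebra(4) B.circ_assoc B.circ_left_commute[of d c] algebra_simps)
    qed (auto simp: co_rules co_outside)
    show "id_cop \<nu> (\<theta> a) = cop_id \<theta> (\<nu> a) + flip12 (id_cop \<theta> (\<nu> a))"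
    proof (rule tri_eqI, goal_cases)
      case (10 p b f c g d h e)
      then show ?case
        by (simp add: co_rules P_coalgebra(5) B.circ_assoc B.circ_left_commute[of d c] algebra_simps)
    qed (auto simp: co_rules co_outside)
    show "cop_id \<nu> (\<theta> a) = id_cop \<theta> (\<nu> a) + flip12 (id_cop \<theta> (\<nu> a))"
    proof (rule tri_eqI, goal_cases)
      case (10 p b f c g d h e)
      \<comment> \<open>The coderivation rule with its sides reversed: skew-symmetry of \<delta>
        moves \<open>h\<close> to the front and back again.\<close>
      have "\<delta> p (dpair \<Delta> f g) h = - (\<Delta> p (dpair \<delta> h f) g + \<Delta> p f (dpair \<delta> h g))"
        by (simp only: P_coalgebra(2)[of p "dpair \<Delta> f g" h] P_coalgebra(5))
      also have "\<dots> = \<Delta> p f (dpair \<delta> g h) + \<Delta> p g (dpair \<delta> f h)"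
        using 10 by (simp add: P_coalgebra(1)[of p "dpair \<delta> f h" g] dpair_delta_skew[of h] dpair_dual_simps Delta_bil)
      finally show ?case using 10
        by (simp add: co_rules B.circ_assoc B.circ_left_commute[of d c] algebra_simps)
    qed (auto simp: co_rules co_outside)
    show "cop_id \<theta> (\<nu> a) = - flip12 (cop_id \<theta> (\<nu> a))"
    proof (rule tri_eqI, goal_cases)
      case (10 p b f c g d h e)
      then show ?case
        by (simp add: co_rules dpair_delta_skew[of g f] B.circ_assoc B.circ_left_commute[of d c])
    qed (auto simp: co_rules co_outside)
  qed
qed


section \<open>Compatibility of products and coproducts\<close>

lemma P_bialgebra:
  assumes "f \<in> dual sP" "g \<in> dual sP"
  shows "\<Delta> (mul p q) f g = \<Delta> p (pull (mul q) f) g + \<Delta> q f (pull (mul p) g)"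
    and "\<delta> (brk p q) f g = \<delta> q (pull (brk p) f) g + \<delta> q f (pull (brk p) g)
      - \<delta> p (pull (brk q) f) g - \<delta> p f (pull (brk q) g)"
    and "\<Delta> (brk p q) f g = \<Delta> q (pull (brk p) f) g + \<Delta> q f (pull (brk p) g)
      + \<delta> p (pull (mul q) f) g - \<delta> p f (pull (mul q) g)"
    and "\<delta> (mul p q) f g = \<delta> q (pull (mul p) f) g + \<delta> p (pull (mul q) f) g
      + \<Delta> q f (pull (brk p) g) + \<Delta> p f (pull (brk q) g)"
  using assms
  by (simp_all add: P.Delta_mul P.delta_brk P.Delta_brk P.delta_mul ten2_op_apply tmap_apply)

text \<open>These express that \<open>\<Delta>(pq) = \<Delta>(qp)\<close> and \<open>\<Delta>([p, q]) = - \<Delta>([q, p])\<close>.\<close>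

lemma P_bialgebra_swap:
  assumes "f \<in> dual sP" "g \<in> dual sP"
  shows "\<Delta> q f (pull (mul p) g) = \<Delta> q (pull (mul p) f) g + \<Delta> p f (pull (mul q) g) - \<Delta> p (pull (mul q) f) g"
    and "\<delta> q f (pull (mul p) g) = \<delta> q (pull (mul p) f) g + \<Delta> q (pull (brk p) f) g + \<Delta> q f (pull (brk p) g)
      + \<delta> p (pull (mul q) f) g - \<delta> p f (pull (mul q) g)
      + \<Delta> p (pull (brk q) f) g + \<Delta> p f (pull (brk q) g)"
proof -
  have "\<Delta> (mul p q) f g = \<Delta> (mul q p) f g" by (simp only: P.mul_commute)
  then show "\<Delta> q f (pull (mul p) g) = \<Delta> q (pull (mul p) f) g + \<Delta> p f (pull (mul q) g) - \<Delta> p (pull (mul q) f) g"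
    using assms by (simp add: P_bialgebra algebra_simps)
  have "\<Delta> (brk q p + brk p q) f g = \<Delta> 0 f g" by (simp add: brk_skew[of q p])
  moreover have "\<Delta> (x + y) = \<Delta> x + \<Delta> y" for x y
    using P.Delta_coproduct by (simp add: coproduct_def Vector_Spaces.linear_iff)
  moreover from this[of 0 0] have "\<Delta> 0 = 0" by (metis add_cancel_right_right add_0)
  ultimately have "\<Delta> (brk q p) f g + \<Delta> (brk p q) f g = 0" by (simp add: ten2_op_apply fun_op_apply)
  then show "\<delta> q f (pull (mul p) g) = \<delta> q (pull (mul p) f) g + \<Delta> q (pull (brk p) f) g + \<Delta> q f (pull (brk p) g)
      + \<delta> p (pull (mul q) f) g - \<delta> p f (pull (mul q) g)
      + \<Delta> p (pull (brk q) f) g + \<Delta> p f (pull (brk q) g)"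
    using assms by (simp add: P_bialgebra algebra_simps)
qed

text \<open>Instantiated at two fixed functionals, these rules put \<open>f\<close> into the first
  slot, transposed or not, so values read in either order meet in one normal form.\<close>

lemma P_flip:
  "\<Delta> x g f = \<Delta> x f g" "\<delta> x g f = - \<delta> x f g"
  "\<Delta> x (pull h g) f = \<Delta> x f (pull h g)" "\<delta> x (pull h g) f = - \<delta> x f (pull h g)"
  "\<Delta> x g (pull h f) = \<Delta> x (pull h f) g" "\<delta> x g (pull h f) = - \<delta> x (pull h f) g"
  by (rule P_coalgebra)+

text \<open>This rule set and the next two serve the premises of \<open>quad_eqI\<close>:
  additivity, default values, and evaluation at generators.\<close>

lemmas quad_rules = ten2_op_apply tmap_apply flip_apply pull_op[where s = sA] pull_lambda[where s = sA] pull_add pull_add_arg pull_dual_simps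
  nu_bil theta_bil nu_theta_add circA_rules astA_rules fn

lemmas quad_outside = ten2_op_apply tmap_apply flip_apply Tens2_outside[OF nu_Tens2] Tens2_outside[OF theta_Tens2]

lemmas gen_rules = ten2_op_apply tmap_apply flip_apply pull_op[where s = sA] pull_lambda[where s = sA] pull_fn pull_dual_simps
  nu_bil theta_bil nu_theta_add circ_ten ast_ten fn fn_rules nu_fn theta_fn
  B.circ_rules B.form_rules B.circ_assoc B.form_right P_bialgebra

text \<open>All twelve conditions have the same proof. At generators both sides are sums of a
  Poisson value times a scalar in \<omega>; \<open>P_flip\<close> and
  \<open>P_bialgebra_swap\<close> normalise the first factors, \<open>form_words\<close> the second,
  and ring arithmetic compares the results. The statements have the shape that the axioms of
  \<open>dpp_bialgebra\<close> take once L, R and the other abbreviations are expanded.\<close>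

lemma induced_perm_bialgebra1: "\<forall>a b. tmap sA ((\<lambda>x. circ x a)) id (\<nu> b) = flip (tmap sA ((\<lambda>x. circ x b)) id (\<nu> a))"
proof (rule quad_eqI, goal_cases)
  case 1
  then show ?case by (auto simp: quad_outside)
next
  case (10 p b q b' f c g d)
  then show ?case
    by (simp add: gen_rules P_flip[where g = g and f = f] P_bialgebra_swap[of f g q p]
        B.form_words[where x = b and y = b' and c = c and d = d] algebra_simps)
qed (simp_all add: quad_rules)

lemma induced_perm_bialgebra2: "\<forall>a b. \<nu> (circ a b) = tmap sA (circ a - (\<lambda>x. circ x a)) id (\<nu> b) + tmap sA id ((\<lambda>x. circ x b)) (\<nu> a)"
proof (rule quad_eqI, goal_cases)
  case 1
  then show ?case by (auto simp: quad_outside)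
next
  case (10 p b q b' f c g d)
  then show ?case
    by (simp add: gen_rules P_flip[where g = g and f = f] P_bialgebra_swap[of f g q p]
        B.form_words[where x = b and y = b' and c = c and d = d] algebra_simps)
qed (simp_all add: quad_rules)

lemma induced_perm_bialgebra3: "\<forall>a b. \<nu> (circ a b) = tmap sA id (circ a) (\<nu> b) + tmap sA (circ b - (\<lambda>x. circ x b)) id (\<nu> a - flip (\<nu> a))"
proof (rule quad_eqI, goal_cases)
  case 1
  then show ?case by (auto simp: quad_outside)
next
  case (10 p b q b' f c g d)
  then show ?case
    by (simp add: gen_rules P_flip[where g = g and f = f] P_bialgebra_swap[of f g q p]
        B.form_words[where x = b and y = b' and c = c and d = d] algebra_simps)
qed (simp_all add: quad_rules)

lemma induced_leibniz_bialgebra1: "\<forall>a b. flip (tmap sA ((\<lambda>x. ast x b)) id (\<theta> a)) = tmap sA ((\<lambda>x. ast x a)) id (\<theta> b)"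
proof (rule quad_eqI, goal_cases)
  case 1
  then show ?case by (auto simp: quad_outside)
next
  case (10 p b q b' f c g d)
  then show ?case
    by (simp add: gen_rules P_flip[where g = g and f = f] P_bialgebra_swap[of f g q p]
        B.form_words[where x = b and y = b' and c = c and d = d] algebra_simps)
qed (simp_all add: quad_rules)

lemma induced_leibniz_bialgebra2: "\<forall>a b. \<theta> (ast a b) = (tmap sA id ((\<lambda>x. ast x b)) - tmap sA (ast b + (\<lambda>x. ast x b)) id) (\<theta> a + flip (\<theta> a)) + (tmap sA id (ast a) + tmap sA (ast a) id) (\<theta> b)"
proof (rule quad_eqI, goal_cases)
  case 1
  then show ?case by (auto simp: quad_outside)
next
  case (10 p b q b' f c g d)
  then show ?case
    by (simp add: gen_rules P_flip[where g = g and f = f] P_bialgebra_swap[of f g q p]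
        B.form_words[where x = b and y = b' and c = c and d = d] algebra_simps)
qed (simp_all add: quad_rules)

lemma induced_dpp_bialgebra1: "\<forall>a b. \<nu> (ast a b) = (tmap sA id (ast a) + tmap sA (ast a) id) (\<nu> b) + (tmap sA (circ b - (\<lambda>x. circ x b)) id - tmap sA id ((\<lambda>x. circ x b))) (\<theta> a + flip (\<theta> a))"
proof (rule quad_eqI, goal_cases)
  case 1
  then show ?case by (auto simp: quad_outside)
next
  case (10 p b q b' f c g d)
  then show ?case
    by (simp add: gen_rules P_flip[where g = g and f = f] P_bialgebra_swap[of f g q p]
        B.form_words[where x = b and y = b' and c = c and d = d] algebra_simps)
qed (simp_all add: quad_rules)

lemma induced_dpp_bialgebra2: "\<forall>a b. \<theta> (circ a b) = tmap sA id (circ a) (\<theta> b) + tmap sA id ((\<lambda>x. circ x b)) (\<theta> a) - tmap sA (ast a + (\<lambda>x. ast x a)) id (\<nu> b) - tmap sA (ast b + (\<lambda>x. ast x b)) id (\<nu> a - flip (\<nu> a))"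
proof (rule quad_eqI, goal_cases)
  case 1
  then show ?case by (auto simp: quad_outside)
next
  case (10 p b q b' f c g d)
  then show ?case
    by (simp add: gen_rules P_flip[where g = g and f = f] P_bialgebra_swap[of f g q p]
        B.form_words[where x = b and y = b' and c = c and d = d] algebra_simps)
qed (simp_all add: quad_rules)

lemma induced_dpp_bialgebra3: "\<forall>a b. tmap sA id ((\<lambda>x. ast x a)) (flip (\<nu> b)) = - tmap sA ((\<lambda>x. circ x b)) id (\<theta> a)"
proof (rule quad_eqI, goal_cases)
  case 1
  then show ?case by (auto simp: quad_outside)
next
  case (10 p b q b' f c g d)
  then show ?case
    by (simp add: gen_rules P_flip[where g = g and f = f] P_bialgebra_swap[of f g q p]
        B.form_words[where x = b and y = b' and c = c and d = d] algebra_simps)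
qed (simp_all add: quad_rules)

lemma induced_dpp_bialgebra4: "\<forall>a b. \<nu> (ast a b) = (tmap sA id (circ a) - tmap sA (circ a) id) (\<theta> b) + (tmap sA id ((\<lambda>x. ast x b)) - tmap sA (ast b + (\<lambda>x. ast x b)) id) (\<nu> a - flip (\<nu> a))"
proof (rule quad_eqI, goal_cases)
  case 1
  then show ?case by (auto simp: quad_outside)
next
  case (10 p b q b' f c g d)
  then show ?case
    by (simp add: gen_rules P_flip[where g = g and f = f] P_bialgebra_swap[of f g q p]
        B.form_words[where x = b and y = b' and c = c and d = d] algebra_simps)
qed (simp_all add: quad_rules)

lemma induced_dpp_bialgebra5: "\<forall>a b. \<theta> (circ a b) + flip (\<theta> (circ a b)) = tmap sA id (circ a) (\<theta> b + flip (\<theta> b)) + tmap sA id (circ b) (\<theta> a + flip (\<theta> a)) - tmap sA (ast a) id (\<nu> b - flip (\<nu> b)) - tmap sA (ast b) id (\<nu> a - flip (\<nu> a))"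
proof (rule quad_eqI, goal_cases)
  case 1
  then show ?case by (auto simp: quad_outside)
next
  case (10 p b q b' f c g d)
  then show ?case
    by (simp add: gen_rules P_flip[where g = g and f = f] P_bialgebra_swap[of f g q p]
        B.form_words[where x = b and y = b' and c = c and d = d] algebra_simps)
qed (simp_all add: quad_rules)

lemma induced_dpp_bialgebra6: "\<forall>a b. \<theta> (circ a b) = tmap sA (circ a) id (\<theta> b) - tmap sA id ((\<lambda>x. ast x b)) (\<nu> a - flip (\<nu> a)) + tmap sA id (ast a) (\<nu> b) + tmap sA (circ b - (\<lambda>x. circ x b)) id (\<theta> a + flip (\<theta> a))"
proof (rule quad_eqI, goal_cases)
  case 1
  then show ?case by (auto simp: quad_outside)
next
  case (10 p b q b' f c g d)
  then show ?case
    by (simp add: gen_rules P_flip[where g = g and f = f] P_bialgebra_swap[of f g q p]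
        B.form_words[where x = b and y = b' and c = c and d = d] algebra_simps)
qed (simp_all add: quad_rules)

lemma induced_dpp_bialgebra7: "\<forall>a b. \<nu> (ast a b + ast b a) = tmap sA id (ast a + (\<lambda>x. ast x a)) (\<nu> b) + tmap sA (ast a + (\<lambda>x. ast x a)) id (flip (\<nu> b)) + tmap sA id (circ b - (\<lambda>x. circ x b)) (\<theta> a) + tmap sA (circ b - (\<lambda>x. circ x b)) id (flip (\<theta> a))"
proof (rule quad_eqI, goal_cases)
  case 1
  then show ?case by (auto simp: quad_outside)
next
  case (10 p b q b' f c g d)
  then show ?case
    by (simp add: gen_rules P_flip[where g = g and f = f] P_bialgebra_swap[of f g q p]
        B.form_words[where x = b and y = b' and c = c and d = d] algebra_simps)
qed (simp_all add: quad_rules)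

end

section \<open>Factorizability\<close>

lemma flip_sum: "flip (\<Sum>i\<in>I. u i) = (\<Sum>i\<in>I. flip (u i))"
  for u :: "'i \<Rightarrow> ('v, 'k::comm_monoid_add) ten2"
  by (simp add: flip_def fun_eq_iff sum_fun_apply)

lemma Tens2_flip: "t \<in> Tens2 s \<Longrightarrow> flip t \<in> Tens2 s"
  by (auto simp: flip_sum flip_tens2 elim!: Tens2E intro: sum_in_Tens2)

lemma Tens2_diff:
  assumes "t \<in> Tens2 s" "u \<in> Tens2 s" shows "t - u \<in> Tens2 s"
proof -
  obtain m x y where u: "u = (\<Sum>i<(m::nat). tens2 s (x i) (y i))" using assms(2) by (rule Tens2E)
  have "- u = (\<Sum>i<m. tens2 s (- x i) (y i))"
    by (auto simp: u fun_eq_iff sum_fun_apply uminus_apply tens2_def sum_negf[symmetric] dual_minus intro!: sum.cong)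
  then have "- u \<in> Tens2 s" by (auto intro: sum_in_Tens2)
  then have "t + (- u) \<in> Tens2 s" by (rule Tens2_add[OF assms(1)])
  then show ?thesis by simp
qed

text \<open>For a decomposed tensor the described vector is the sum of the \<open>y i\<close>
  weighted by \<open>\<xi> (x i)\<close>; functionals separate vectors, so it is unique.\<close>

lemma sharp_apply:
  assumes "vector_space s" "t \<in> Tens2 s" "\<xi> \<in> dual s" "\<eta> \<in> dual s"
  shows "\<eta> (sharp s t \<xi>) = t \<xi> \<eta>"
proof -
  interpret vector_space s by fact
  obtain n x y where t: "t = (\<Sum>i<(n::nat). tens2 s (x i) (y i))" using assms(2) by (rule Tens2E)
  have "\<forall>\<eta>\<in>dual s. \<eta> (\<Sum>i<n. s (\<xi> (x i)) (y i)) = t \<xi> \<eta>"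
    using assms(3) by (simp add: t sum_fun_apply dual_sum dual_scale)
  then have "\<exists>!v. \<forall>\<eta>\<in>dual s. \<eta> v = t \<xi> \<eta>"
    by (intro ex_ex1I) (blast, auto intro: dual_separates_eq)
  from theI'[OF this] show ?thesis using assms(4) unfolding sharp_def by blast
qed

text \<open>Additivity in each slot together with the default value 0. Its closure properties let
  the Yang-Baxter expressions be tested at generators without expanding them for general
  functionals.\<close>

definition trilinear :: "('k::field \<Rightarrow> 'v::ab_group_add \<Rightarrow> 'v) \<Rightarrow> ('v, 'k) ten3 \<Rightarrow> bool" where
  "trilinear s X \<longleftrightarrow>
    (\<forall>\<xi> \<eta> \<zeta>. \<not> (\<xi> \<in> dual s \<and> \<eta> \<in> dual s \<and> \<zeta> \<in> dual s) \<longrightarrow> X \<xi> \<eta> \<zeta> = 0) \<and>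
    (\<forall>\<xi>\<in>dual s. \<forall>\<xi>'\<in>dual s. \<forall>\<eta>\<in>dual s. \<forall>\<zeta>\<in>dual s. X (\<xi> + \<xi>') \<eta> \<zeta> = X \<xi> \<eta> \<zeta> + X \<xi>' \<eta> \<zeta>) \<and>
    (\<forall>\<xi>\<in>dual s. \<forall>\<eta>\<in>dual s. \<forall>\<eta>'\<in>dual s. \<forall>\<zeta>\<in>dual s. X \<xi> (\<eta> + \<eta>') \<zeta> = X \<xi> \<eta> \<zeta> + X \<xi> \<eta>' \<zeta>) \<and>
    (\<forall>\<xi>\<in>dual s. \<forall>\<eta>\<in>dual s. \<forall>\<zeta>\<in>dual s. \<forall>\<zeta>'\<in>dual s. X \<xi> \<eta> (\<zeta> + \<zeta>') = X \<xi> \<eta> \<zeta> + X \<xi> \<eta> \<zeta>')"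

lemma trilinear_closed:
  assumes "vector_space s"
  shows "trilinear s (tens3 s x y z)"
    and "trilinear s X \<Longrightarrow> trilinear s Y \<Longrightarrow> trilinear s (X + Y)"
    and "trilinear s X \<Longrightarrow> trilinear s Y \<Longrightarrow> trilinear s (X - Y)"
    and "(\<And>i. trilinear s (F i)) \<Longrightarrow> trilinear s (\<Sum>i\<in>I. F i)"
proof -
  interpret vector_space s by fact
  show "trilinear s (tens3 s x y z)"
    by (auto simp: trilinear_def tens3_def plus_fun_apply algebra_simps)
  show "trilinear s X \<Longrightarrow> trilinear s Y \<Longrightarrow> trilinear s (X + Y)"
    by (auto simp: trilinear_def ten3_op_apply)
  show "trilinear s X \<Longrightarrow> trilinear s Y \<Longrightarrow> trilinear s (X - Y)"
    by (auto simp: trilinear_def ten3_op_apply)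
  show "(\<And>i. trilinear s (F i)) \<Longrightarrow> trilinear s (\<Sum>i\<in>I. F i)"
    by (auto simp: trilinear_def sum_fun_apply sum.distrib)
qed

text \<open>An enumeration of \<open>I\<close> provides the initial segment that
  \<open>dp_ybe\<close> asks for; here \<open>I\<close> will consist of pairs of an index of r and a
  Casimir index.\<close>

lemma dp_ybeI:
  assumes "finite I" "t = (\<Sum>i\<in>I. tens2 s (x i) (y i))"
    and "(\<Sum>i\<in>I. \<Sum>j\<in>I. tens3 s (x i) (circ (y i) (x j)) (y j)
        - tens3 s (x i) (x j) (circ (y i) (y j))
        + tens3 s (circ (x i) (x j)) (y i) (y j)
        - tens3 s (circ (x i) (x j)) (y j) (y i)) = 0"
    and "(\<Sum>i\<in>I. \<Sum>j\<in>I. tens3 s (ast (x i) (x j)) (y i) (y j)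
        - tens3 s (x i) (ast (y i) (x j)) (y j)
        - tens3 s (x j) (ast (x i) (y j)) (y i)
        + tens3 s (x j) (x i) (ast (y i) (y j))) = 0"
  shows "dp_ybe s circ ast t"
proof -
  obtain h where h: "bij_betw h {..<card I} I"
    using ex_bij_betw_nat_finite[OF assms(1)] by (auto simp: lessThan_atLeast0)
  note * = sum.reindex_bij_betw[OF h, symmetric]
  show ?thesis unfolding dp_ybe_def
    using assms(2-4) unfolding *
    by (intro exI[of _ "card I"] exI[of _ "\<lambda>i. x (h i)"] exI[of _ "\<lambda>i. y (h i)"]) simp
qed

text \<open>This splits a Yang-Baxter sum for the tensor product into a Poisson sum and a Casimir
  sum.\<close>

lemma sum_prod_separate:
  fixes F :: "'i \<Rightarrow> 'i \<Rightarrow> 'k::comm_semiring_0" and G :: "'j \<Rightarrow> 'j \<Rightarrow> 'k"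
  shows "(\<Sum>z\<in>A \<times> B. \<Sum>w\<in>A \<times> B. F (fst z) (fst w) * G (snd z) (snd w)) =
    (\<Sum>i\<in>A. \<Sum>j\<in>A. F i j) * (\<Sum>k\<in>B. \<Sum>l\<in>B. G k l)"
proof -
  have pr: "(\<Sum>z\<in>A \<times> B. H (fst z) (snd z)) = (\<Sum>i\<in>A. \<Sum>k\<in>B. H i k)" for H :: "'i \<Rightarrow> 'j \<Rightarrow> 'k"
    by (simp add: sum.cartesian_product split_def)
  have "(\<Sum>z\<in>A \<times> B. \<Sum>w\<in>A \<times> B. F (fst z) (fst w) * G (snd z) (snd w)) =
      (\<Sum>i\<in>A. \<Sum>k\<in>B. \<Sum>w\<in>A \<times> B. F i (fst w) * G k (snd w))"
    by (rule pr[of "\<lambda>i k. \<Sum>w\<in>A \<times> B. F i (fst w) * G k (snd w)"])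
  also have "\<dots> = (\<Sum>i\<in>A. \<Sum>k\<in>B. \<Sum>j\<in>A. \<Sum>l\<in>B. F i j * G k l)"
    by (intro sum.cong refl pr)
  also have "\<dots> = (\<Sum>i\<in>A. \<Sum>j\<in>A. \<Sum>k\<in>B. \<Sum>l\<in>B. F i j * G k l)"
    by (intro sum.cong refl sum.swap)
  also have "\<dots> = (\<Sum>i\<in>A. \<Sum>j\<in>A. F i j) * (\<Sum>k\<in>B. \<Sum>l\<in>B. G k l)"
    unfolding sum_distrib_right unfolding sum_distrib_left ..
  finally show ?thesis .
qed

section \<open>The induced bialgebra and the transfer of r-matrices\<close>

context induced_structure
begin

lemma dpp_bialgebra: "dpp_bialgebra sA circ ast \<nu> \<theta>"
proof -
  interpret A: dpp_algebra sA circ ast by (rule dpp_algebra)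
  interpret C: dpp_coalgebra sA \<nu> \<theta> by (rule dpp_coalgebra)
  show ?thesis
    by (unfold_locales;
      rule induced_perm_bialgebra1[rule_format] induced_perm_bialgebra2[rule_format] induced_perm_bialgebra3[rule_format]
        induced_leibniz_bialgebra1[rule_format] induced_leibniz_bialgebra2[rule_format]
        induced_dpp_bialgebra1[rule_format] induced_dpp_bialgebra2[rule_format] induced_dpp_bialgebra3[rule_format]
        induced_dpp_bialgebra4[rule_format] induced_dpp_bialgebra5[rule_format] induced_dpp_bialgebra6[rule_format]
        induced_dpp_bialgebra7[rule_format])
qed

lemma ten3_zeroI:
  assumes "trilinear sA X"
    and "\<And>f c g d h e. f \<in> dual sP \<Longrightarrow> g \<in> dual sP \<Longrightarrow> h \<in> dual sP \<Longrightarrow> X (fn f c) (fn g d) (fn h e) = 0"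
  shows "X = 0"
proof (intro ext)
  fix \<xi> \<eta> \<zeta>
  have "X \<xi> \<eta> \<zeta> = 0"
  proof (cases "\<xi> \<in> dual sA \<and> \<eta> \<in> dual sA \<and> \<zeta> \<in> dual sA")
    case True
    show ?thesis
      by (rule tri_fn_zero[where Q = X]) (use assms True in \<open>simp_all add: trilinear_def\<close>)
  qed (use assms in \<open>auto simp: trilinear_def\<close>)
  then show "X \<xi> \<eta> \<zeta> = 0 \<xi> \<eta> \<zeta>" by (simp add: zero_fun_apply)
qed

text \<open>Coboundaries evaluate to scalars \<omega>(c, -), the induced coproducts to \<omega>(b,
  -); this translates between them.\<close>

lemma form_rotate: "\<omega> b (circB c d) = \<omega> c (circB b d) - \<omega> c (circB d b)"
  using B.form_left[of c b d] B.form_right[of c b d] by simp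

text \<open>Passing from r to the tensor on P \<otimes> B commutes with taking coboundaries. After
  transposition both summands of either coboundary carry the same scalar
  \<open>\<omega> b (circB c d)\<close>, by \<open>form_rotate\<close> and the adjoint of R.\<close>

lemma r_structure:
  assumes r: "r \<in> Tens2 sP" and t: "t \<in> Tens2 sA"
    and tr: "\<And>f c g d. f \<in> dual sP \<Longrightarrow> g \<in> dual sP \<Longrightarrow> t (fn f c) (fn g d) = - (r f g * \<omega> c d)"
  shows nu_of_gen: "f \<in> dual sP \<Longrightarrow> g \<in> dual sP \<Longrightarrow>
      nu_of sA circ t (ten p b) (fn f c) (fn g d) = - (Delta_of sP mul r p f g * \<omega> b (circB c d))"
    and theta_of_gen: "f \<in> dual sP \<Longrightarrow> g \<in> dual sP \<Longrightarrow>
      theta_of sA ast t (ten p b) (fn f c) (fn g d) = - (delta_of sP brk r p f g * \<omega> b (circB c d))"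
proof -
  note t_bil = Tens2_bilinear[OF T.vector_space_axioms t] Tens2_homogeneous(1,2)[OF T.vector_space_axioms t]
  assume "f \<in> dual sP" "g \<in> dual sP"
  then show "nu_of sA circ t (ten p b) (fn f c) (fn g d) = - (Delta_of sP mul r p f g * \<omega> b (circB c d))"
    "theta_of sA ast t (ten p b) (fn f c) (fn g d) = - (delta_of sP brk r p f g * \<omega> b (circB c d))"
    by (simp_all add: nu_of_def theta_of_def Delta_of_def delta_of_def ten2_op_apply tmap_apply
        pull_lambda[where s = sA] pull_fn pull_dual_simps fn fn_rules t_bil tr B.form_rules B.form_right
        form_rotate[of b c d] algebra_simps)
qed


text \<open>Used in two ways: with the induced coproducts and r, to show that they are coboundaries,
  and with the zero map and r + \<tau>(r), to show invariance.\<close>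

lemma coboundary_eqI:
  assumes r: "r \<in> Tens2 sP" and t: "t \<in> Tens2 sA"
    and tr: "\<And>f c g d. f \<in> dual sP \<Longrightarrow> g \<in> dual sP \<Longrightarrow> t (fn f c) (fn g d) = - (r f g * \<omega> c d)"
    and X: "\<And>a. X a \<in> Tens2 sA" "\<And>a b. X (a + b) = X a + X b"
  shows "(\<And>p b f c g d. f \<in> dual sP \<Longrightarrow> g \<in> dual sP \<Longrightarrow>
      X (ten p b) (fn f c) (fn g d) = - (Delta_of sP mul r p f g * \<omega> b (circB c d))) \<Longrightarrow> X = nu_of sA circ t"
    and "(\<And>p b f c g d. f \<in> dual sP \<Longrightarrow> g \<in> dual sP \<Longrightarrow>
      X (ten p b) (fn f c) (fn g d) = - (delta_of sP brk r p f g * \<omega> b (circB c d))) \<Longrightarrow> X = theta_of sA ast t"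
proof -
  note bil = Tens2_bilinear[OF T.vector_space_axioms t] Tens2_bilinear[OF T.vector_space_axioms X(1)]
  note rules = nu_of_def theta_of_def ten2_op_apply tmap_apply pull_lambda[where s = sA] pull_add
    pull_add_arg pull_dual_simps bil X(2) circA_rules astA_rules
  note out = nu_of_def theta_of_def ten2_op_apply tmap_apply Tens2_outside[OF X(1)]
  show "X = nu_of sA circ t" if "\<And>p b f c g d. f \<in> dual sP \<Longrightarrow> g \<in> dual sP \<Longrightarrow>
      X (ten p b) (fn f c) (fn g d) = - (Delta_of sP mul r p f g * \<omega> b (circB c d))"
  proof (rule lin_eqI, goal_cases)
    case 1
    then show ?case by (auto simp: out)
  next
    case (8 p b f c g d)
    then show ?case by (simp add: that nu_of_gen[OF r t tr])
  qed (simp_all add: rules)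
  show "X = theta_of sA ast t" if "\<And>p b f c g d. f \<in> dual sP \<Longrightarrow> g \<in> dual sP \<Longrightarrow>
      X (ten p b) (fn f c) (fn g d) = - (delta_of sP brk r p f g * \<omega> b (circB c d))"
  proof (rule lin_eqI, goal_cases)
    case 1
    then show ?case by (auto simp: out)
  next
    case (8 p b f c g d)
    then show ?case by (simp add: that theta_of_gen[OF r t tr])
  qed (simp_all add: rules)
qed

text \<open>Let F and G be the maps for P \<otimes> B and P. Since F sends [f, -b] to the pure
  tensor of \<open>G f\<close> and \<open>b\<close>, surjectivity of G gives that of F. The pairing
  \<eta>(F \<xi>) is skew-symmetric, so surjectivity in turn forces injectivity.\<close>

lemma dual_iso_transfer:
  assumes r: "r \<in> Tens2 sP" and t: "t \<in> Tens2 sA"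
    and tr: "\<And>f c g d. f \<in> dual sP \<Longrightarrow> g \<in> dual sP \<Longrightarrow> t (fn f c) (fn g d) = - (r f g * \<omega> c d)"
    and iso: "dual_iso sP (\<lambda>\<xi>. sharp sP r \<xi> + sharp sP (flip r) \<xi>)"
  shows "dual_iso sA (\<lambda>\<xi>. sharp sA t \<xi> - sharp sA (flip t) \<xi>)"
proof -
  define F where "F \<xi> = sharp sA t \<xi> - sharp sA (flip t) \<xi>" for \<xi>
  define G where "G \<xi> = sharp sP r \<xi> + sharp sP (flip r) \<xi>" for \<xi>
  have F: "\<eta> (F \<xi>) = t \<xi> \<eta> - t \<eta> \<xi>" if "\<xi> \<in> dual sA" "\<eta> \<in> dual sA" for \<xi> \<eta>
    using that by (simp add: F_def dual_diff sharp_apply T.vector_space_axioms t Tens2_flip flip_apply)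
  have G: "g (G f) = r f g + r g f" if "f \<in> dual sP" "g \<in> dual sP" for f g
    using that by (simp add: G_def dual_add sharp_apply P.vector_space_axioms r Tens2_flip flip_apply)
  note t_bil = Tens2_bilinear[OF T.vector_space_axioms t] Tens2_homogeneous[OF T.vector_space_axioms t]
  have F_add: "F (\<xi> + \<eta>) = F \<xi> + F \<eta>" if "\<xi> \<in> dual sA" "\<eta> \<in> dual sA" for \<xi> \<eta>
    by (rule T.dual_separates_eq) (simp add: F that dual_add t_bil)
  have F_scale: "F (\<lambda>x. c * \<xi> x) = sA c (F \<xi>)" if "\<xi> \<in> dual sA" for \<xi> c
    by (rule T.dual_separates_eq) (simp add: F that dual_scale t_bil right_diff_distrib)
  have "\<exists>\<xi>\<in>dual sA. F \<xi> = x" for x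
  proof (induction x rule: ten_induct)
    case (1 p b)
    obtain f where f: "f \<in> dual sP" "G f = p"
      using iso unfolding dual_iso_def G_def[symmetric] bij_betw_def by (metis UNIV_I imageE)
    \<comment> \<open>The negated \<open>b\<close> compensates the minus sign in the values of
      \<open>t\<close>.\<close>
    have "F (fn f (- b)) = ten p b"
    proof (rule T.dual_separates_eq)
      fix \<eta> assume "\<eta> \<in> dual sA"
      then show "\<eta> (F (fn f (- b))) = \<eta> (ten p b)"
      proof (induction \<eta> rule: dual_induct)
        case (1 g d)
        have "fn g d (F (fn f (- b))) = r f g * \<omega> b d - r g f * \<omega> d b"
          using 1 f by (simp add: F fn tr B.form_rules)
        also have "\<dots> = g (G f) * \<omega> b d"
          using 1 f(1) by (simp add: G B.form_skew[of d b] algebra_simps)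
        also have "\<dots> = fn g d (ten p b)" using 1 f by (simp add: fn)
        finally show ?case .
      qed (simp add: plus_fun_apply)
    qed
    then show ?case using f by (auto intro: fn)
  next
    case (2 x y)
    then obtain \<xi> \<eta> where "\<xi> \<in> dual sA" "\<eta> \<in> dual sA" "F \<xi> = x" "F \<eta> = y" by blast
    then show ?case by (intro bexI[of _ "\<xi> + \<eta>"]) (simp_all add: F_add)
  qed
  then have surj: "F ` dual sA = UNIV" by (auto simp: image_iff) metis
  moreover have "inj_on F (dual sA)"
  proof (rule inj_onI, rule ext)
    fix \<xi> \<eta> x assume *: "\<xi> \<in> dual sA" "\<eta> \<in> dual sA" "F \<xi> = F \<eta>"
    obtain \<mu> where \<mu>: "\<mu> \<in> dual sA" "x = F \<mu>" using surj by blast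
    \<comment> \<open>By skew-symmetry the value at \<open>x = F \<mu>\<close> depends on the
      functional only through its image under \<open>F\<close>.\<close>
    have "\<xi> x = - \<mu> (F \<xi>)" "\<eta> x = - \<mu> (F \<eta>)" using *(1,2) \<mu> by (simp_all add: F)
    then show "\<xi> x = \<eta> x" by (simp only: *(3))
  qed
  ultimately show ?thesis
    using F_add F_scale unfolding dual_iso_def F_def[symmetric] bij_betw_def by blast
qed


text \<open>The tensors of \<open>u k\<close> and \<open>v k\<close> enter only through the two
  contraction identities. At generators each term of the DPYBE factors into a term of the PoiYBE and
  a scalar in \<open>c\<close>, \<open>d\<close>, \<open>e\<close>.\<close>

lemma dp_ybe_transfer:
  fixes n :: nat
  assumes ybe1: "(\<Sum>i<n. \<Sum>j<n. tens3 sP (mul (x i) (x j)) (y i) (y j)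
        + tens3 sP (x i) (x j) (mul (y i) (y j))
        - tens3 sP (x j) (mul (x i) (y j)) (y i)) = 0"
    and ybe2: "(\<Sum>i<n. \<Sum>j<n. tens3 sP (brk (x i) (x j)) (y i) (y j)
        + tens3 sP (x i) (x j) (brk (y i) (y j))
        + tens3 sP (x i) (brk (y i) (x j)) (y j)) = 0"
    and E: "finite E" and cas1: "\<And>d. (\<Sum>k\<in>E. sB (\<omega> (v k) d) (u k)) = d"
    and cas2: "\<And>c. (\<Sum>k\<in>E. sB (\<omega> (u k) c) (v k)) = - c"
  shows "dp_ybe sA circ ast (\<Sum>z\<in>{..<n} \<times> E. tens2 sA (ten (x (fst z)) (u (snd z))) (ten (y (fst z)) (v (snd z))))"
proof -
  define I where "I = {..<n} \<times> E"
  define X where "X z = ten (x (fst z)) (u (snd z))" for z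
  define Y where "Y z = ten (y (fst z)) (v (snd z))" for z
  note trilin = trilinear_closed[OF T.vector_space_axioms]
  \<comment> \<open>The contraction of two Casimir tensors: the weights move inside the product by
    bilinearity.\<close>
  have B: "(\<Sum>k\<in>E. \<Sum>l\<in>E. \<alpha> k * \<beta> l * \<omega> (circB (w k) (w' l)) d) =
      \<omega> (circB (\<Sum>k\<in>E. sB (\<alpha> k) (w k)) (\<Sum>l\<in>E. sB (\<beta> l) (w' l))) d" for \<alpha> \<beta> w w' d
    by (subst sum.swap) (simp add: bilinear_op_sum[OF B.circ_bilinear] bilinear_op_sum[OF B.form_bilinear]
        B.circ_rules B.form_rules B.scale_sum_right mult.assoc mult.left_commute)
  have sw: "(\<Sum>i<n. \<Sum>j<n. H i j) = (\<Sum>i<n. \<Sum>j<n. H j i)" for H :: "nat \<Rightarrow> nat \<Rightarrow> 'k"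
    by (rule sum.swap)
  have main: "(\<Sum>z\<in>I. \<Sum>w\<in>I. tens3 sA (X z) (circ (Y z) (X w)) (Y w)
        - tens3 sA (X z) (X w) (circ (Y z) (Y w))
        + tens3 sA (circ (X z) (X w)) (Y z) (Y w)
        - tens3 sA (circ (X z) (X w)) (Y w) (Y z)) = 0 \<and>
     (\<Sum>z\<in>I. \<Sum>w\<in>I. tens3 sA (ast (X z) (X w)) (Y z) (Y w)
        - tens3 sA (X z) (ast (Y z) (X w)) (Y w)
        - tens3 sA (X w) (ast (X z) (Y w)) (Y z)
        + tens3 sA (X w) (X z) (ast (Y z) (Y w))) = 0" (is "?C = 0 \<and> ?D = 0")
  proof (intro conjI ten3_zeroI)
    show "trilinear sA ?C" "trilinear sA ?D" by (intro trilin)+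
    fix f c g d h e
    assume dual: "f \<in> dual sP" "g \<in> dual sP" "h \<in> dual sP"
    note fnd = dual dual[THEN fn_dual]
    define S where "S F = (\<Sum>i<n. \<Sum>j<n. F i j)" for F :: "nat \<Rightarrow> nat \<Rightarrow> 'k"
    have sep: "(\<Sum>z\<in>I. \<Sum>w\<in>I. F (fst z) (fst w) * (\<alpha> (snd z) * \<beta> (snd w) * \<omega> (circB (p (snd z)) (q (snd w))) b)) =
      S F * \<omega> (circB (\<Sum>k\<in>E. sB (\<alpha> k) (p k)) (\<Sum>l\<in>E. sB (\<beta> l) (q l))) b" for F \<alpha> \<beta> p q b
      unfolding I_def S_def B[symmetric] by (rule sum_prod_separate)
    \<comment> \<open>The terms of the two Poisson equations evaluated at \<open>f\<close>,
      \<open>g\<close>, \<open>h\<close>.\<close>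
    define A1 A2 A3 where "A1 = S (\<lambda>i j. f (mul (x i) (x j)) * g (y i) * h (y j))"
      and "A2 = S (\<lambda>i j. f (x i) * g (x j) * h (mul (y i) (y j)))"
      and "A3 = S (\<lambda>i j. f (x j) * g (mul (x i) (y j)) * h (y i))"
    define B1 B2 B3 where "B1 = S (\<lambda>i j. f (brk (x i) (x j)) * g (y i) * h (y j))"
      and "B2 = S (\<lambda>i j. f (x i) * g (x j) * h (brk (y i) (y j)))"
      and "B3 = S (\<lambda>i j. f (x i) * g (brk (y i) (x j)) * h (y j))"
    have A: "A1 + A2 - A3 = 0"
      using fun_cong[OF fun_cong[OF fun_cong[OF ybe1, of f], of g], of h] dual
      by (simp add: A1_def A2_def A3_def S_def sum_fun_apply ten3_op_apply tens3_def
          sum.distrib sum_subtractf zero_fun_apply)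
    have Bsum: "B1 + B2 + B3 = 0"
      using fun_cong[OF fun_cong[OF fun_cong[OF ybe2, of f], of g], of h] dual
      by (simp add: B1_def B2_def B3_def S_def sum_fun_apply ten3_op_apply tens3_def
          sum.distrib zero_fun_apply)
    \<comment> \<open>The DPYBE lists the two summation indices in another order. Renaming them and
      using commutativity of the product or skew-symmetry of the bracket recovers the Poisson terms,
      with a sign for the bracket.\<close>
    have A1': "S (\<lambda>i j. f (mul (x i) (x j)) * g (y j) * h (y i)) = A1"
      unfolding A1_def S_def by (subst sw) (simp only: P.mul_commute)
    have A3': "S (\<lambda>i j. f (x i) * g (mul (y i) (x j)) * h (y j)) = A3"
      unfolding A3_def S_def by (subst sw) (simp only: P.mul_commute)
    have B2': "S (\<lambda>i j. f (x j) * g (x i) * h (brk (y i) (y j))) = - B2"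
      unfolding B2_def S_def sum_negf[symmetric]
      by (subst sw, intro sum.cong refl, subst brk_skew) (simp add: dual_minus[OF dual(3)])
    have B3': "S (\<lambda>i j. f (x j) * g (brk (x i) (y j)) * h (y i)) = - B3"
      unfolding B3_def S_def sum_negf[symmetric]
      by (subst sw, intro sum.cong refl, subst brk_skew) (simp add: dual_minus[OF dual(2)])
    note ev = sum_fun_apply ten3_op_apply tens3_def fnd if_True simp_thms X_def Y_def circ_ten ast_ten fn_ten
    \<comment> \<open>\<open>w1\<close> and \<open>w2\<close> lead to
      \<open>\<omega> (circB d c) e\<close> for the bracket equation, \<open>w3\<close> and
      \<open>w4\<close> to \<open>\<omega> (circB c d) e\<close> for the product equation; the
      additional pairings in \<open>w2\<close> and \<open>w4\<close> cancel in the final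
      sums.\<close>
    have w1: "\<omega> (circB d e) c = - \<omega> (circB d c) e"
      by (rule trans[OF B.form_left B.form_skew])
    have w2: "\<omega> (circB c e) d = \<omega> (circB e c) d - \<omega> (circB d c) e"
      using B.form_right[of d c e] B.form_skew[of d "circB c e"] B.form_skew[of d "circB e c"] by simp
    have w3: "\<omega> (circB c e) d = - \<omega> (circB c d) e"
      by (rule trans[OF B.form_left B.form_skew])
    have w4: "\<omega> (circB e d) c = \<omega> (circB d e) c + \<omega> (circB c d) e"
      using B.form_right[of c d e] B.form_skew[of c "circB d e"] B.form_skew[of c "circB e d"] by simp
    \<comment> \<open>In each of the eight terms two Casimir legs meet functionals and their
      partners are multiplied: \<open>cas1\<close> returns the argument, \<open>cas2\<close> its
      negative.\<close>
    have C1: "(\<Sum>z\<in>I. \<Sum>w\<in>I. tens3 sA (X z) (circ (Y z) (X w)) (Y w) (fn f c) (fn g d) (fn h e)) = A3 * \<omega> (circB (- c) e) d"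
      using sep[of "\<lambda>i j. f (x i) * g (mul (y i) (x j)) * h (y j)" "\<lambda>k. \<omega> (u k) c" "\<lambda>l. \<omega> (v l) e" v u d]
      unfolding cas1 cas2 A3'[symmetric] by (simp add: ev ac_simps)
    have C2: "(\<Sum>z\<in>I. \<Sum>w\<in>I. tens3 sA (X z) (X w) (circ (Y z) (Y w)) (fn f c) (fn g d) (fn h e)) = A2 * \<omega> (circB (- c) (- d)) e"
      using sep[of "\<lambda>i j. f (x i) * g (x j) * h (mul (y i) (y j))" "\<lambda>k. \<omega> (u k) c" "\<lambda>l. \<omega> (u l) d" v v e]
      unfolding cas1 cas2 A2_def[symmetric] by (simp add: ev ac_simps)
    have C3: "(\<Sum>z\<in>I. \<Sum>w\<in>I. tens3 sA (circ (X z) (X w)) (Y z) (Y w) (fn f c) (fn g d) (fn h e)) = A1 * \<omega> (circB d e) c"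
      using sep[of "\<lambda>i j. f (mul (x i) (x j)) * g (y i) * h (y j)" "\<lambda>k. \<omega> (v k) d" "\<lambda>l. \<omega> (v l) e" u u c]
      unfolding cas1 cas2 A1_def[symmetric] by (simp add: ev ac_simps)
    have C4: "(\<Sum>z\<in>I. \<Sum>w\<in>I. tens3 sA (circ (X z) (X w)) (Y w) (Y z) (fn f c) (fn g d) (fn h e)) = A1 * \<omega> (circB e d) c"
      using sep[of "\<lambda>i j. f (mul (x i) (x j)) * g (y j) * h (y i)" "\<lambda>k. \<omega> (v k) e" "\<lambda>l. \<omega> (v l) d" u u c]
      unfolding cas1 cas2 A1'[symmetric] by (simp add: ev ac_simps)
    have D1: "(\<Sum>z\<in>I. \<Sum>w\<in>I. tens3 sA (ast (X z) (X w)) (Y z) (Y w) (fn f c) (fn g d) (fn h e)) = B1 * \<omega> (circB d e) c"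
      using sep[of "\<lambda>i j. f (brk (x i) (x j)) * g (y i) * h (y j)" "\<lambda>k. \<omega> (v k) d" "\<lambda>l. \<omega> (v l) e" u u c]
      unfolding cas1 cas2 B1_def[symmetric] by (simp add: ev ac_simps)
    have D2: "(\<Sum>z\<in>I. \<Sum>w\<in>I. tens3 sA (X z) (ast (Y z) (X w)) (Y w) (fn f c) (fn g d) (fn h e)) = B3 * \<omega> (circB (- c) e) d"
      using sep[of "\<lambda>i j. f (x i) * g (brk (y i) (x j)) * h (y j)" "\<lambda>k. \<omega> (u k) c" "\<lambda>l. \<omega> (v l) e" v u d]
      unfolding cas1 cas2 B3_def[symmetric] by (simp add: ev ac_simps)
    have D3: "(\<Sum>z\<in>I. \<Sum>w\<in>I. tens3 sA (X w) (ast (X z) (Y w)) (Y z) (fn f c) (fn g d) (fn h e)) = - B3 * \<omega> (circB e (- c)) d"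
      using sep[of "\<lambda>i j. f (x j) * g (brk (x i) (y j)) * h (y i)" "\<lambda>k. \<omega> (v k) e" "\<lambda>l. \<omega> (u l) c" u v d]
      unfolding cas1 cas2 B3'[symmetric] by (simp add: ev ac_simps)
    have D4: "(\<Sum>z\<in>I. \<Sum>w\<in>I. tens3 sA (X w) (X z) (ast (Y z) (Y w)) (fn f c) (fn g d) (fn h e)) = - B2 * \<omega> (circB (- d) (- c)) e"
      using sep[of "\<lambda>i j. f (x j) * g (x i) * h (brk (y i) (y j))" "\<lambda>k. \<omega> (u k) d" "\<lambda>l. \<omega> (u l) c" v v e]
      unfolding cas1 cas2 B2'[symmetric] by (simp add: ev ac_simps)
    note split = sum_fun_apply ten3_op_apply sum.distrib sum_subtractf
    have "?C (fn f c) (fn g d) (fn h e) = (A3 - A2 - A1) * \<omega> (circB c d) e"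
      unfolding split C1 C2 C3 C4 by (simp add: B.circ_rules B.form_rules w3 w4 algebra_simps)
    also have "A3 - A2 - A1 = - (A1 + A2 - A3)" by simp
    finally show "?C (fn f c) (fn g d) (fn h e) = 0" by (simp add: A)
    have "?D (fn f c) (fn g d) (fn h e) = - (B1 + B2 + B3) * \<omega> (circB d c) e"
      unfolding split D1 D2 D3 D4 by (simp add: B.circ_rules B.form_rules w1 w2 algebra_simps)
    then show "?D (fn f c) (fn g d) (fn h e) = 0" by (simp add: Bsum)
  qed
  show ?thesis
    by (rule dp_ybeI[OF _ _ conjunct1[OF main] conjunct2[OF main]]) (simp_all add: I_def X_def Y_def E)
qed


section \<open>Assembly of the factorizable structure\<close>

lemma factorizable_transfer:
  assumes "factorizable_poisson_bialgebra sP mul brk \<Delta> \<delta>"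
  shows "factorizable_dpp_bialgebra sA circ ast \<nu> \<theta>"
proof -
  obtain r where r: "r \<in> Tens2 sP" and ybe: "poi_ybe sP mul brk r"
    and cob: "\<Delta> = Delta_of sP mul r" "\<delta> = delta_of sP brk r"
    and inv: "poi_invariant sP mul brk (r + flip r)"
    and iso: "dual_iso sP (\<lambda>\<xi>. sharp sP r \<xi> + sharp sP (flip r) \<xi>)"
    using assms unfolding factorizable_poisson_bialgebra_def by blast
  obtain n :: nat and x y where r_eq: "r = (\<Sum>i<n. tens2 sP (x i) (y i))"
    and ybe1: "(\<Sum>i<n. \<Sum>j<n. tens3 sP (mul (x i) (x j)) (y i) (y j)
        + tens3 sP (x i) (x j) (mul (y i) (y j))
        - tens3 sP (x j) (mul (x i) (y j)) (y i)) = 0"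
    and ybe2: "(\<Sum>i<n. \<Sum>j<n. tens3 sP (brk (x i) (x j)) (y i) (y j)
        + tens3 sP (x i) (x j) (brk (y i) (y j))
        + tens3 sP (x i) (brk (y i) (x j)) (y j)) = 0"
    using ybe unfolding poi_ybe_def by blast
  obtain E v where E: "finite E" and cas1: "\<And>d. (\<Sum>k\<in>E. sB (\<omega> (v k) d) k) = d"
    and cas2: "\<And>c. (\<Sum>k\<in>E. sB (\<omega> k c) (v k)) = - c"
    by (rule B.casimir) blast
  \<comment> \<open>The tensor s described at the outset; the first Casimir legs are the elements of
    \<open>E\<close>, so they index themselves.\<close>
  define t where "t = (\<Sum>z\<in>{..<n} \<times> E. tens2 sA (ten (x (fst z)) (snd z)) (ten (y (fst z)) (v (snd z))))"
  have t: "t \<in> Tens2 sA" unfolding t_def by (rule sum_in_Tens2) (simp add: E)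
  have tr: "t (fn f c) (fn g d) = - (r f g * \<omega> c d)" if "f \<in> dual sP" "g \<in> dual sP" for f c g d
  proof -
    have "t (fn f c) (fn g d) = (\<Sum>i<n. \<Sum>k\<in>E. f (x i) * g (y i) * (\<omega> k c * \<omega> (v k) d))"
      using that by (simp add: t_def sum_fun_apply fn sum.cartesian_product split_def ac_simps)
    also have "\<dots> = r f g * \<omega> (\<Sum>k\<in>E. sB (\<omega> k c) (v k)) d"
      using that by (simp add: r_eq sum_fun_apply sum_product bilinear_op_sum[OF B.form_bilinear] B.form_rules)
    finally show ?thesis by (simp add: cas2 B.form_rules)
  qed
  have r': "r + flip r \<in> Tens2 sP" by (rule Tens2_add[OF r Tens2_flip[OF r]])
  have t': "t - flip t \<in> Tens2 sA" by (rule Tens2_diff[OF t Tens2_flip[OF t]])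
  \<comment> \<open>Exchanging the arguments of \<omega> changes the sign, so the difference
    upstairs matches the sum for r, and \<open>coboundary_eqI\<close> applies to this pair as
    well.\<close>
  have tr': "(t - flip t) (fn f c) (fn g d) = - ((r + flip r) f g * \<omega> c d)"
    if "f \<in> dual sP" "g \<in> dual sP" for f c g d
    using that by (simp add: ten2_op_apply flip_apply tr B.form_skew[of d c] algebra_simps)
  have "\<nu> = nu_of sA circ t"
    by (rule coboundary_eqI(1)[OF r t tr nu_Tens2 nu_theta_add(1)])
       (simp_all add: nu_fn cob(1)[symmetric])
  moreover have "\<theta> = theta_of sA ast t"
    by (rule coboundary_eqI(2)[OF r t tr theta_Tens2 nu_theta_add(2)])
       (simp_all add: theta_fn cob(2)[symmetric])
  moreover have "dp_invariant sA circ ast (t - flip t)"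
  proof -
    have 0: "(0 :: ('a, 'k) ten2) \<in> Tens2 sA" using sum_in_Tens2[of "{}" sA] by simp
    \<comment> \<open>Invariance says that the zero map is the coboundary of
      \<open>t - flip t\<close>, which on generators is the assumed invariance of
      \<open>r + flip r\<close>.\<close>
    have "(\<lambda>_. 0) = nu_of sA circ (t - flip t)"
      by (rule coboundary_eqI(1)[OF r' t' tr'])
         (use inv 0 in \<open>simp_all add: poi_invariant_def zero_fun_apply\<close>)
    moreover have "(\<lambda>_. 0) = theta_of sA ast (t - flip t)"
      by (rule coboundary_eqI(2)[OF r' t' tr'])
         (use inv 0 in \<open>simp_all add: poi_invariant_def zero_fun_apply\<close>)
    ultimately show ?thesis by (simp add: dp_invariant_def zero_fun_def)
  qed
  moreover have "dp_ybe sA circ ast t"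
    unfolding t_def by (rule dp_ybe_transfer[OF ybe1 ybe2 E cas1 cas2])
  moreover have "dual_iso sA (\<lambda>\<xi>. sharp sA t \<xi> - sharp sA (flip t) \<xi>)"
    by (rule dual_iso_transfer[OF r t tr iso])
  ultimately show ?thesis
    unfolding factorizable_dpp_bialgebra_def using dpp_bialgebra t by blast
qed

end

theorem proposition4p22:
  fixes sP :: "'k::field_char_0 \<Rightarrow> 'p::ab_group_add \<Rightarrow> 'p"
    and sB :: "'k \<Rightarrow> 'b::ab_group_add \<Rightarrow> 'b"
    and sA :: "'k \<Rightarrow> 'a::ab_group_add \<Rightarrow> 'a"
    and mul brk :: "'p \<Rightarrow> 'p \<Rightarrow> 'p"
    and \<Delta> \<delta> :: "'p \<Rightarrow> ('p, 'k) ten2"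
    and circB :: "'b \<Rightarrow> 'b \<Rightarrow> 'b"
    and \<omega> :: "'b \<Rightarrow> 'b \<Rightarrow> 'k"
    and ten :: "'p \<Rightarrow> 'b \<Rightarrow> 'a"
    and circ ast :: "'a \<Rightarrow> 'a \<Rightarrow> 'a"
    and \<nu> \<theta> :: "'a \<Rightarrow> ('a, 'k) ten2"
  assumes "poisson_bialgebra sP mul brk \<Delta> \<delta>"
    and "quadratic_perm_algebra sB circB \<omega>"
    and "tensor_product sP sB sA ten"
    and "bilinear_op sA sA sA circ"
    and "\<And>p1 b1 p2 b2. circ (ten p1 b1) (ten p2 b2) = ten (mul p1 p2) (circB b1 b2)"
    and "bilinear_op sA sA sA ast"
    and "\<And>p1 b1 p2 b2. ast (ten p1 b1) (ten p2 b2) = ten (brk p1 p2) (circB b1 b2)"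
    and "Vector_Spaces.linear sA scale2 \<nu>"
    and "\<And>p b. \<nu> (ten p b) = bullet sP sB sA ten (\<Delta> p) (nu_form sB circB \<omega> b)"
    and "Vector_Spaces.linear sA scale2 \<theta>"
    and "\<And>p b. \<theta> (ten p b) = bullet sP sB sA ten (\<delta> p) (nu_form sB circB \<omega> b)"
    and "factorizable_poisson_bialgebra sP mul brk \<Delta> \<delta>"
  shows "factorizable_dpp_bialgebra sA circ ast \<nu> \<theta>"
proof -
  interpret induced_structure sP mul brk \<Delta> \<delta> sB circB \<omega> sA ten circ ast \<nu> \<theta>
    using assms by (intro induced_structure.intro induced_structure_axioms.intro)
  show ?thesis using assms(12) by (rule factorizable_transfer)
qed

end
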